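(* Let $f\colon[0,1]\to[0,1]$ be a Manneville--Pomeau type map with branch point $r_1$, let $F\colon[r_1,1]\to[r_1,1]$ be its induced first return map, and let $q=r_1$ if $f$ is increasing on $(r_1,1]$ and $q=1$ if $f$ is decreasing on $(r_1,1]$. Then the exceptional set $$\mathcal E_F(q)=\big\{x\in[r_1,1]\colon q\notin\overline{\{F^n(x)\colon n\ge0\}}\big\}$$ is absolute winning in $[r_1,1]$.
   Context: **Manneville--Pomeau type map.** A two-branch interval map $f\colon[0,1]\to[0,1]$ for which there is $r_1\in(0,1)$ such that (using one-sided derivatives, i.e. derivatives of the one-sided branch extensions, as needed): (1) $f((0,r_1))=f((r_1,1))=(0,1)$; (2) $f$ is $C^1$ on $[0,r_1)$ and $C^2$ on $(0,r_1)\cup(r_1,1]$; (3) $f(0)=f(r_1)=0$, $f'(0)=1$, and $|f'|>1$ on $(0,1]$ (hence $\inf_{x\in[\epsilon,1]}|f'|>1$ for all $\epsilon>0$); (4) $\sup_{x\in[0,1]}|f'(x)|<\infty$ and $\sup_{x\in(r_1,1]}|f''(x)|<\infty$; (5) there exist $C\ge1$ and $\gamma>0$ such that $C^{-1}\le f''(x)/x^{\gamma-1}\le C$ for $x\in(0,r_1)$. The branch of $f$ on $(r_1,1]$ is monotone and may have either orientation. The value $f(r_1)=0$ is a convention. **Induced map.** Let $\tau(x)=\inf\{n\ge1\colon f^n(x)\in[r_1,1]\}$, with $\inf\emptyset=\infty$. Define $F\colon[r_1,1]\to[r_1,1]$ by $F(x)=f^{\tau(x)}(x)$ whenever $\tau(x)<\infty$,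 and assign $F(x)\in\{r_1,1\}$ arbitrarily when $\tau(x)=\infty$. **Absolute game.** Let $I\subset\mathbb R$ be a nontrivial compact interval, $S\subset I$, and $0<\beta<1/3$. In the $\beta$-absolute game Bob chooses a nontrivial closed interval $B_1\subset I$. After Bob chooses $B_n$, Alice deletes a closed interval $A_n\subset B_n$ with $|A_n|\le\beta|B_n|$. Bob then chooses a closed interval $B_{n+1}\subset B_n\setminus A_n$ with $|B_{n+1}|\ge\beta|B_n|$. Alice wins if $\bigcap_n B_n$ meets $S$. The set $S$ is $\beta$-absolute winning in $I$ if Alice can win regardless of Bob's choices, and absolute winning in $I$ if it is $\beta$-absolute winning for every $0<\beta<1/3$. Here $|\cdot|$ denotes length. *)

theory Defs
  imports "HOL-Analysis.Analysis" "HOL-Library.Extended_Nat"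
begin

section \<open>Manneville--Pomeau type maps\<close>

text \<open>
  The functions \<open>fl\<close> and \<open>fr\<close> are the extensions of the two branches of \<open>f\<close> to the closed
  intervals \<open>{0..r1}\<close> and \<open>{r1..1}\<close>; their derivatives \<open>fl'\<close> and \<open>fr'\<close> are taken within these
  intervals, hence one-sided at the endpoints. In particular \<open>f'\<close> at \<open>r1\<close> is read as the two
  numbers \<open>fl' r1\<close> and \<open>fr' r1\<close>, since \<open>f\<close> itself is discontinuous there. All five functions are
  determined by \<open>f\<close> on the sets used. That \<open>fl\<close> and \<open>fr\<close> are differentiable at
  \<open>r1\<close> is no additional restriction: by the bounds on \<open>f''\<close> the derivative of each branch
  has a finite limit at \<open>r1\<close>.
\<close>

definition Manneville_Pomeau :: "(real \<Rightarrow> real) \<Rightarrow> real \<Rightarrow> bool" where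
  "Manneville_Pomeau f r1 \<longleftrightarrow>
    0 < r1 \<and> r1 < 1 \<and> f ` {0..1} \<subseteq> {0..1} \<and>
    f ` {0<..<r1} = {0<..<1} \<and> f ` {r1<..<1} = {0<..<1} \<and>
    f 0 = 0 \<and> f r1 = 0 \<and>
    (\<exists>fl fr fl' fr' f'' :: real \<Rightarrow> real.
      (\<forall>x\<in>{0..<r1}. fl x = f x) \<and> (\<forall>x\<in>{r1<..1}. fr x = f x) \<and>
      (\<forall>x\<in>{0..r1}. (fl has_real_derivative fl' x) (at x within {0..r1})) \<and>
      (\<forall>x\<in>{r1..1}. (fr has_real_derivative fr' x) (at x within {r1..1})) \<and>
      continuous_on {0..<r1} fl' \<and> continuous_on {r1<..1} fr' \<and>
      (\<forall>x\<in>{0<..<r1}. (fl' has_real_derivative f'' x) (at x within {0<..<r1})) \<and>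
      (\<forall>x\<in>{r1<..1}. (fr' has_real_derivative f'' x) (at x within {r1<..1})) \<and>
      continuous_on ({0<..<r1} \<union> {r1<..1}) f'' \<and>
      fl' 0 = 1 \<and> (\<forall>x\<in>{0<..r1}. \<bar>fl' x\<bar> > 1) \<and> (\<forall>x\<in>{r1..1}. \<bar>fr' x\<bar> > 1) \<and>
      bdd_above ((\<lambda>x. \<bar>fl' x\<bar>) ` {0..r1}) \<and> bdd_above ((\<lambda>x. \<bar>fr' x\<bar>) ` {r1..1}) \<and>
      bdd_above ((\<lambda>x. \<bar>f'' x\<bar>) ` {r1<..1}) \<and>
      (\<exists>C \<gamma> :: real. C \<ge> 1 \<and> \<gamma> > 0 \<and>
        (\<forall>x\<in>{0<..<r1}. inverse C \<le> f'' x / x powr (\<gamma> - 1) \<and> f'' x / x powr (\<gamma> - 1) \<le> C)))"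

section \<open>The induced map\<close>

definition return_time :: "(real \<Rightarrow> real) \<Rightarrow> real \<Rightarrow> real \<Rightarrow> enat" where
  "return_time f r1 x = Inf (enat ` {n. n \<ge> 1 \<and> (f ^^ n) x \<in> {r1..1}})"

text \<open>
  A predicate rather than a function, because the values of \<open>F\<close> at points of infinite return
  time may be chosen arbitrarily in \<open>{r1, 1}\<close>. Values of \<open>F\<close> outside \<open>{r1..1}\<close> play no role.
\<close>

definition induced_map :: "(real \<Rightarrow> real) \<Rightarrow> real \<Rightarrow> (real \<Rightarrow> real) \<Rightarrow> bool" where
  "induced_map f r1 F \<longleftrightarrow>
    (\<forall>x\<in>{r1..1}. if return_time f r1 x = \<infinity> then F x \<in> {r1, 1}
                  else F x = (f ^^ the_enat (return_time f r1 x)) x)"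

definition exceptional_set :: "(real \<Rightarrow> real) \<Rightarrow> real set \<Rightarrow> real \<Rightarrow> real set" where
  "exceptional_set F X q = {x \<in> X. q \<notin> closure (range (\<lambda>n. (F ^^ n) x))}"

section \<open>The absolute game\<close>

definition closed_interval :: "real set \<Rightarrow> bool" where
  "closed_interval J \<longleftrightarrow> (\<exists>a b. a \<le> b \<and> J = {a..b})"

abbreviation len :: "real set \<Rightarrow> real" where
  "len J \<equiv> measure lborel J"

definition alice_move :: "real \<Rightarrow> real set \<Rightarrow> real set \<Rightarrow> bool" where
  "alice_move \<beta> B A \<longleftrightarrow> closed_interval A \<and> A \<subseteq> B \<and> len A \<le> \<beta> * len B"

definition bob_move :: "real \<Rightarrow> real set \<Rightarrow> real set \<Rightarrow> real set \<Rightarrow> bool" where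
  "bob_move \<beta> B A B' \<longleftrightarrow> closed_interval B' \<and> B' \<subseteq> B - A \<and> len B' \<ge> \<beta> * len B"

text \<open>
  A strategy maps the list of Bob's moves so far (most recent last) to Alice's answer. It must
  give a legal answer after every history, so that Alice cannot win by leaving Bob without a move;
  asking this also of histories that never occur is harmless, as a strategy can be changed there.
\<close>

definition alice_strategy :: "real \<Rightarrow> (real set list \<Rightarrow> real set) \<Rightarrow> bool" where
  "alice_strategy \<beta> \<sigma> \<longleftrightarrow>
    (\<forall>Bs B. closed_interval B \<and> len B > 0 \<longrightarrow> alice_move \<beta> B (\<sigma> (Bs @ [B])))"

text \<open>Bob's intervals are numbered from 0.\<close>

definition bob_play ::
    "real \<Rightarrow> real set \<Rightarrow> (real set list \<Rightarrow> real set) \<Rightarrow> (nat \<Rightarrow> real set) \<Rightarrow> bool" where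
  "bob_play \<beta> I \<sigma> B \<longleftrightarrow>
    closed_interval (B 0) \<and> len (B 0) > 0 \<and> B 0 \<subseteq> I \<and>
    (\<forall>n. bob_move \<beta> (B n) (\<sigma> (map B [0..<Suc n])) (B (Suc n)))"

definition beta_absolute_winning :: "real \<Rightarrow> real set \<Rightarrow> real set \<Rightarrow> bool" where
  "beta_absolute_winning \<beta> I S \<longleftrightarrow>
    (\<exists>\<sigma>. alice_strategy \<beta> \<sigma> \<and> (\<forall>B. bob_play \<beta> I \<sigma> B \<longrightarrow> (\<Inter>n. B n) \<inter> S \<noteq> {}))"

definition absolute_winning :: "real set \<Rightarrow> real set \<Rightarrow> bool" where
  "absolute_winning I S \<longleftrightarrow> (\<forall>\<beta>. 0 < \<beta> \<and> \<beta> < 1/3 \<longrightarrow> beta_absolute_winning \<beta> I S)"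

end

theory Submission
  imports Defs
begin

text \<open>
  Let \<open>gL\<close> and \<open>gR\<close> be the inverses of the two branches of \<open>f\<close>, and for a word \<open>w\<close> in the letters
  \<open>L\<close>, \<open>R\<close> let \<open>pull w\<close> be the corresponding composition. In both orientations \<open>q = gR 0\<close>, and an
  \<open>F\<close>-orbit can approach \<open>q\<close> only if the \<open>f\<close>-orbit comes close to \<open>0\<close> one step later. Small values of an
  \<open>f\<close>-orbit arise first as images under the right branch, because the left branch moves points away
  from \<open>0\<close>. Hence \<open>x\<close> is exceptional as soon as, for some \<open>\<delta> > 0\<close> and all words \<open>w\<close> ending in \<open>R\<close>, its
  distance to \<open>pull w 0\<close> exceeds \<open>\<delta>\<close> times the width of the cylinder \<open>pull w ` {0..1}\<close>
  (\<open>avoiding_subset_exceptional\<close>). This describes the exceptional set like a set of badly approximable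
  numbers, with the points \<open>pull w 0\<close> as rationals and the widths as the natural scale.

  Two facts then give the theorem. In the absolute game Alice can keep such proportional distances from
  any family of points that is separated in the sense that two different points are at least \<open>\<kappa>\<close> times
  the smaller of their widths apart: at each scale at most one of these points is near Bob's interval,
  and she deletes a neighbourhood of it (\<open>absolute_winning_avoid_separated\<close>). And the points
  \<open>pull w 0\<close> are separated in this sense (\<open>zeros_separated\<close>).

  Separation follows from bounded distortion: for \<open>w\<close> ending in \<open>R\<close> the map \<open>pull w\<close> is, up to a factor
  that does not depend on \<open>w\<close>, a similarity of \<open>{0..1}\<close> with ratio the width of \<open>w\<close>
  (\<open>returning_similar\<close>). The neutral fixed point is the only obstacle. Along a laminar block
  \<open>L\<dots>LR\<close>, successive images lie in the consecutive intervals \<open>{level (k + 1)..level k}\<close> between the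
  iterated preimages of \<open>1\<close> under the left branch. Since the derivative of that branch increases, the
  oscillations of the derivative over these intervals telescope, so a block of any length has
  distortion at most a constant. The two-sided bound on \<open>f''\<close> makes the second derivative comparable at
  all points of one such interval, which refines the constant to a multiple of the diameter of the set
  considered. These diameters decrease geometrically from block to block, because \<open>gR\<close> contracts
  uniformly, so the contributions of all blocks add up to a bounded quantity.
\<close>

section \<open>Avoiding separated points in the absolute game\<close>

text \<open>
  A legal answer to \<open>B\<close> of the largest possible length, as close to being centred at \<open>z\<close> as \<open>B\<close> permits.
  Always using up the full length forces Bob's intervals to shrink geometrically.
\<close>

definition trim :: "real \<Rightarrow> real \<Rightarrow> real set \<Rightarrow> real set" where
  "trim \<beta> z B = (let l = Inf B; u = Sup B; c = \<beta> * (u - l); a = max l (min (z - c/2) (u - c)) in {a..a + c})"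

lemma trim_props:
  assumes "0 < \<beta>" "\<beta> < 1" "closed_interval B"
  shows "alice_move \<beta> B (trim \<beta> z B)"
    and "len (trim \<beta> z B) = \<beta> * len B"
    and "B \<inter> {z - \<beta>/2 * len B..z + \<beta>/2 * len B} \<subseteq> trim \<beta> z B"
proof -
  obtain l u where B: "l \<le> u" "B = {l..u}" using assms(3) by (auto simp: closed_interval_def)
  define c where "c = \<beta> * (u - l)"
  define a where "a = max l (min (z - c/2) (u - c))"
  have c: "0 \<le> c" "c \<le> u - l" using assms B by (auto simp: c_def mult_left_le_one_le)
  have t: "trim \<beta> z B = {a..a+c}" using B by (simp add: trim_def a_def c_def Let_def)
  have a: "l \<le> a" "a \<le> u - c" using c by (auto simp: a_def)
  show "len (trim \<beta> z B) = \<beta> * len B" using t B c by (simp add: c_def)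
  then show "alice_move \<beta> B (trim \<beta> z B)"
    using t B a c by (auto simp: alice_move_def closed_interval_def)
  show "B \<inter> {z - \<beta>/2 * len B..z + \<beta>/2 * len B} \<subseteq> trim \<beta> z B"
    using t B c by (auto simp: a_def c_def)
qed

lemma bob_move_shrinks:
  assumes "closed_interval B" "bob_move \<beta> B A B'" "closed_interval A" "A \<subseteq> B"
  shows "len B' \<le> len B - len A"
proof -
  have "B' \<union> A \<subseteq> B" "B' \<inter> A = {}" using assms by (auto simp: bob_move_def)
  moreover have m: "A \<in> fmeasurable lborel" "B' \<in> fmeasurable lborel" "B \<in> fmeasurable lborel"
    using assms by (auto simp: bob_move_def closed_interval_def fmeasurable_cbox intro: fmeasurable_compact)
  moreover have "len (B' \<union> A) = len B' + len A" using m \<open>B' \<inter> A = {}\<close>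
    by (simp add: measure_Un3)
  moreover have "len (B' \<union> A) \<le> len B" 
    using m(3) \<open>B' \<union> A \<subseteq> B\<close> m(1,2)[THEN fmeasurableD]
    by (intro measure_mono_fmeasurable) auto
  ultimately show ?thesis by simp
qed

lemma absolute_winning_mono:
  assumes "absolute_winning I S" "S \<subseteq> S'"
  shows "absolute_winning I S'"
  using assms unfolding absolute_winning_def beta_absolute_winning_def by (meson Int_mono disjoint_iff subset_iff)

text \<open>
  The constant \<open>\<delta>\<close> is fixed after Bob's first move. The invariant of the play is that a forbidden
  neighbourhood \<open>{z i - \<delta> * lam i..z i + \<delta> * lam i}\<close> which still meets Bob's interval \<open>B\<close> has radius at
  most \<open>\<beta>/2 * len B\<close>. It holds initially because \<open>\<delta>\<close> is small, and it can fail after Bob's next move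
  only for radii in the window from \<open>\<beta>/2 * (\<beta> * len B)\<close> to \<open>\<beta>/2 * len B\<close>. By separation all
  neighbourhoods in this window that meet \<open>B\<close> have the same centre, so that one deleted interval of
  length \<open>\<beta> * len B\<close> covers their intersections with \<open>B\<close>. As the lengths tend to \<open>0\<close>, no
  forbidden neighbourhood meets all of Bob's intervals.
\<close>

lemma absolute_winning_avoid_separated:
  fixes z lam :: "'i \<Rightarrow> real" and I :: "real set"
  assumes lam: "\<And>i. i \<in> W \<Longrightarrow> 0 < lam i \<and> lam i \<le> 1"
    and "0 < \<kappa>"
    and sep: "\<And>i j. i \<in> W \<Longrightarrow> j \<in> W \<Longrightarrow> z i \<noteq> z j \<Longrightarrow> \<kappa> * min (lam i) (lam j) \<le> \<bar>z i - z j\<bar>"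
  shows "absolute_winning I {x \<in> I. \<exists>\<delta>>0. \<forall>i\<in>W. \<delta> * lam i < \<bar>x - z i\<bar>}"
  unfolding absolute_winning_def
proof (intro allI impI)
  fix \<beta> :: real assume "0 < \<beta> \<and> \<beta> < 1/3"
  then have \<beta>: "0 < \<beta>" "\<beta> < 1" by auto
  define meets where "meets \<delta> B i \<longleftrightarrow> i \<in> W \<and> {z i - \<delta> * lam i..z i + \<delta> * lam i} \<inter> B \<noteq> {}" for \<delta> B i
  define current where "current \<delta> B i \<longleftrightarrow> meets \<delta> B i \<and> \<beta>/2 * (\<beta> * len B) < \<delta> * lam i
      \<and> \<delta> * lam i \<le> \<beta>/2 * len B" for \<delta> B i
  define radius where "radius b = min (\<beta>/2 * b) (\<kappa> * \<beta>\<^sup>2 / 2 / (1 + \<beta>))" for b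
  define \<sigma> where "\<sigma> Bs = trim \<beta> (z (SOME i. current (radius (len (hd Bs))) (last Bs) i)) (last Bs)" for Bs
  \<comment> \<open>If the centres differed, they would be at most (1 + \<beta>) * len B apart, while separation and the
    lower end of the window put them more than \<kappa> * \<beta>^2 / 2 * len B / \<delta> apart. The second bound
    in the definition of the radius is what makes this impossible.\<close>
  have same: "z i = z j" if B: "closed_interval B" "0 < len B" and d: "0 < \<delta>" "\<delta> \<le> \<kappa> * \<beta>\<^sup>2 / 2 / (1 + \<beta>)"
    and c: "current \<delta> B i" "current \<delta> B j" for \<delta> B i j
  proof (rule ccontr)
    assume "z i \<noteq> z j"
    moreover have W: "i \<in> W" "j \<in> W" using c by (auto simp: current_def meets_def)
    ultimately have s: "\<kappa> * min (lam i) (lam j) \<le> \<bar>z i - z j\<bar>" using sep by blast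
    obtain l u where lu: "l \<le> u" "B = {l..u}" using B by (auto simp: closed_interval_def)
    obtain x y where xy: "x \<in> B" "y \<in> B" "\<bar>x - z i\<bar> \<le> \<delta> * lam i" "\<bar>y - z j\<bar> \<le> \<delta> * lam j"
      using c unfolding current_def meets_def by (fastforce simp: abs_le_iff)
    have "\<bar>x - y\<bar> \<le> len B" using xy(1,2) lu by auto
    then have "\<bar>z i - z j\<bar> \<le> len B + \<beta>/2 * len B + \<beta>/2 * len B"
      using xy(3,4) c unfolding current_def by linarith
    then have up: "\<bar>z i - z j\<bar> \<le> (1 + \<beta>) * len B" by (simp add: algebra_simps)
    have "\<beta>/2 * (\<beta> * len B) < \<delta> * min (lam i) (lam j)"
      using c unfolding current_def by (auto simp: min_def)
    then have "\<kappa> * (\<beta>/2 * (\<beta> * len B)) < \<kappa> * (\<delta> * min (lam i) (lam j))"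
      using \<open>0 < \<kappa>\<close> by simp
    also have "\<dots> = \<delta> * (\<kappa> * min (lam i) (lam j))" by simp
    also have "\<dots> \<le> \<delta> * ((1 + \<beta>) * len B)" using s up d by simp
    also have "\<dots> \<le> (\<kappa> * \<beta>\<^sup>2 / 2 / (1 + \<beta>)) * ((1 + \<beta>) * len B)"
      using d(2) \<beta> B by (intro mult_right_mono) auto
    also have "\<dots> = \<kappa> * (\<beta>/2 * (\<beta> * len B))" using \<beta> by (simp add: power2_eq_square field_simps)
    finally show False by simp
  qed
  have legal: "alice_strategy \<beta> \<sigma>"
    using trim_props(1)[OF \<beta>] by (simp add: alice_strategy_def \<sigma>_def)
  moreover have "(\<Inter>n. B n) \<inter> {x \<in> I. \<exists>\<delta>>0. \<forall>i\<in>W. \<delta> * lam i < \<bar>x - z i\<bar>} \<noteq> {}"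
    if play: "bob_play \<beta> I \<sigma> B" for B
  proof -
    define \<delta> where "\<delta> = radius (len (B 0))"
    define A where "A n = trim \<beta> (z (SOME i. current \<delta> (B n) i)) (B n)" for n
    have "\<sigma> (map B [0..<Suc n]) = A n" for n
    proof -
      have "hd (map B [0..<Suc n]) = B 0" by (simp add: hd_map hd_append)
      moreover have "last (map B [0..<Suc n]) = B n" by simp
      ultimately show ?thesis by (simp only: \<sigma>_def A_def \<delta>_def)
    qed
    then have bob: "bob_move \<beta> (B n) (A n) (B (Suc n))" for n
      using play by (simp add: bob_play_def)
    have B0: "closed_interval (B 0)" "0 < len (B 0)" "B 0 \<subseteq> I" using play by (auto simp: bob_play_def)
    have ci: "closed_interval (B n)" for n
      by (cases n) (use B0 bob in \<open>auto simp: bob_move_def\<close>)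
    have pos: "0 < len (B n)" for n
    proof (induction n)
      case (Suc n)
      then have "0 < \<beta> * len (B n)" using \<beta> by simp
      also have "\<dots> \<le> len (B (Suc n))" using bob by (simp add: bob_move_def)
      finally show ?case .
    qed (use B0 in simp)
    have \<delta>: "0 < \<delta>" "\<delta> \<le> \<beta>/2 * len (B 0)" "\<delta> \<le> \<kappa> * \<beta>\<^sup>2 / 2 / (1 + \<beta>)"
      unfolding \<delta>_def radius_def using \<beta> B0 \<open>0 < \<kappa>\<close>
      by (simp_all only: min.cobounded1 min.cobounded2) simp
    have nest: "B (Suc n) \<subseteq> B n - A n" for n using bob by (simp add: bob_move_def)
    have shrink: "len (B n) \<le> (1 - \<beta>) ^ n * len (B 0)" for n
    proof (induction n)
      case (Suc n)
      have "len (B (Suc n)) \<le> len (B n) - len (A n)"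
        using bob_move_shrinks[OF ci bob] trim_props(1)[OF \<beta> ci] by (simp add: A_def alice_move_def)
      also have "\<dots> = (1 - \<beta>) * len (B n)"
        using trim_props(2)[OF \<beta> ci] by (simp add: A_def algebra_simps)
      also have "\<dots> \<le> (1 - \<beta>) * ((1 - \<beta>) ^ n * len (B 0))" using Suc \<beta> by (intro mult_left_mono) auto
      finally show ?case by simp
    qed simp
    have inv: "\<delta> * lam i \<le> \<beta>/2 * len (B n)" if "meets \<delta> (B n) i" for n i
      using that
    proof (induction n arbitrary: i)
      case 0
      then have "lam i \<le> 1" using lam by (simp add: meets_def)
      then have "\<delta> * lam i \<le> \<delta>" using \<delta>(1) by (simp add: mult_left_le)
      then show ?case using \<delta>(2) by (rule order_trans)
    next
      case (Suc n)
      then obtain x where x: "x \<in> B (Suc n)" "\<bar>x - z i\<bar> \<le> \<delta> * lam i" "i \<in> W"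
        by (fastforce simp: meets_def abs_le_iff)
      have m: "meets \<delta> (B n) i" using Suc.prems nest[of n] by (auto simp: meets_def)
      then have le: "\<delta> * lam i \<le> \<beta>/2 * len (B n)" by (rule Suc.IH)
      have "\<delta> * lam i \<le> \<beta>/2 * (\<beta> * len (B n))"
      proof (rule ccontr)
        assume "\<not> ?thesis"
        then have cur: "current \<delta> (B n) i" using m le by (simp add: current_def)
        then have "current \<delta> (B n) (SOME i. current \<delta> (B n) i)" by (rule someI)
        then have "z (SOME i. current \<delta> (B n) i) = z i" using same[OF ci pos \<delta>(1,3)] cur by blast
        moreover have "x \<in> B n \<inter> {z i - \<beta>/2 * len (B n)..z i + \<beta>/2 * len (B n)}"
          using x nest[of n] le by (auto simp: abs_le_iff)
        ultimately have "x \<in> A n"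
          using trim_props(3)[OF \<beta> ci[of n], where z = "z i"] unfolding A_def by auto
        then show False using x nest[of n] by auto
      qed
      also have "\<dots> \<le> \<beta>/2 * len (B (Suc n))" using bob[of n] \<beta> by (simp add: bob_move_def)
      finally show ?case .
    qed
    have dec: "B (Suc n) \<subseteq> B n" for n using nest by blast
    have "(\<Inter>n. B n) \<noteq> {}"
    proof (rule compact_nest)
      show "compact (B n)" "B n \<noteq> {}" for n using ci[of n] by (auto simp: closed_interval_def)
      show "B n \<subseteq> B m" if "m \<le> n" for m n using lift_Suc_antimono_le[of B, OF dec that] .
    qed
    then obtain x where x: "\<And>n. x \<in> B n" by auto
    have "\<delta> * lam i < \<bar>x - z i\<bar>" if i: "i \<in> W" for i
    proof (rule ccontr)
      assume "\<not> ?thesis"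
      then have "x \<in> {z i - \<delta> * lam i..z i + \<delta> * lam i} \<inter> B n" for n using x[of n] by auto
      then have "meets \<delta> (B n) i" for n using i unfolding meets_def by blast
      then have "\<delta> * lam i \<le> \<beta>/2 * ((1 - \<beta>) ^ n * len (B 0))" for n
        using inv[of n i] shrink[of n] \<beta> by (smt (verit, best) half_gt_zero mult_left_mono)
      moreover have lim: "(\<lambda>n. \<beta>/2 * ((1 - \<beta>) ^ n * len (B 0))) \<longlonglongrightarrow> \<beta>/2 * (0 * len (B 0))"
        using \<beta> by (intro tendsto_intros) auto
      ultimately have "\<delta> * lam i \<le> \<beta>/2 * (0 * len (B 0))"
        by (intro LIMSEQ_le_const[OF lim]) blast
      then show False using \<delta> lam[OF i] by (simp add: mult_le_0_iff)
    qed
    then have "\<exists>\<delta>>0. \<forall>i\<in>W. \<delta> * lam i < \<bar>x - z i\<bar>" using \<delta>(1) by blast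
    moreover have "x \<in> I" using x[of 0] B0(3) by blast
    ultimately show ?thesis using x by blast
  qed
  ultimately show "beta_absolute_winning \<beta> I {x \<in> I. \<exists>\<delta>>0. \<forall>i\<in>W. \<delta> * lam i < \<bar>x - z i\<bar>}"
    unfolding beta_absolute_winning_def by blast
qed

section \<open>Distortion of real maps\<close>

lemma mvt_within:
  fixes \<phi> \<phi>' :: "real \<Rightarrow> real"
  assumes "a < b" "\<And>x. x \<in> {a..b} \<Longrightarrow> (\<phi> has_real_derivative \<phi>' x) (at x within {a..b})"
  obtains \<xi> where "a < \<xi>" "\<xi> < b" "\<phi> b - \<phi> a = \<phi>' \<xi> * (b - a)"
proof -
  have "\<exists>\<xi>\<in>{a<..<b}. \<phi> b - \<phi> a = (\<lambda>h. \<phi>' \<xi> * h) (b - a)"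
    using assms by (intro mvt_simple) (auto simp: has_field_derivative_def)
  then show ?thesis using that by auto
qed

lemma le_exp_mult:
  fixes p q c :: real assumes "1 \<le> q" "0 \<le> c" "p \<le> q + c" shows "p \<le> exp c * q"
proof -
  have "q + c \<le> (1 + c) * q" using mult_left_mono[of 1 q c] assms by (simp add: algebra_simps)
  also have "\<dots> \<le> exp c * q" using assms by (intro mult_right_mono exp_ge_add_one_self) auto
  finally show ?thesis using assms by linarith
qed

text \<open>
  The ratio of two difference quotients of \<open>\<phi>\<close> on \<open>S\<close> is at most \<open>exp c\<close>. In this form distortion needs
  no derivative of \<open>\<phi>\<close>, and the exponents add up under composition.
\<close>

definition distort :: "(real \<Rightarrow> real) \<Rightarrow> real set \<Rightarrow> real \<Rightarrow> bool" where
  "distort \<phi> S c \<longleftrightarrow> (\<forall>x\<in>S. \<forall>y\<in>S. \<forall>u\<in>S. \<forall>v\<in>S.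
     \<bar>\<phi> x - \<phi> y\<bar> * \<bar>u - v\<bar> \<le> exp c * \<bar>\<phi> u - \<phi> v\<bar> * \<bar>x - y\<bar>)"

lemma distort_mono: "distort \<phi> S c \<Longrightarrow> c \<le> c' \<Longrightarrow> T \<subseteq> S \<Longrightarrow> distort \<phi> T c'"
  unfolding distort_def
  by (meson exp_le_cancel_iff mult_right_mono abs_ge_zero order_trans subsetD)

lemma distort_id: "distort (\<lambda>x. x) S 0" by (simp add: distort_def mult.commute)

lemma distort_comp:
  assumes \<phi>: "distort \<phi> (\<psi> ` S) c" and \<psi>: "distort \<psi> S d" and inj: "inj_on \<psi> S"
  shows "distort (\<lambda>x. \<phi> (\<psi> x)) S (c + d)"
  unfolding distort_def
proof (intro ballI)
  fix x y u v assume S: "x \<in> S" "y \<in> S" "u \<in> S" "v \<in> S"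
  show "\<bar>\<phi> (\<psi> x) - \<phi> (\<psi> y)\<bar> * \<bar>u - v\<bar> \<le> exp (c + d) * \<bar>\<phi> (\<psi> u) - \<phi> (\<psi> v)\<bar> * \<bar>x - y\<bar>"
  proof (cases "u = v")
    case False
    then have pos: "0 < \<bar>\<psi> u - \<psi> v\<bar>" using inj S by (auto dest: inj_onD)
    have "\<bar>\<phi> (\<psi> x) - \<phi> (\<psi> y)\<bar> * \<bar>u - v\<bar> * \<bar>\<psi> u - \<psi> v\<bar>
        \<le> exp c * \<bar>\<phi> (\<psi> u) - \<phi> (\<psi> v)\<bar> * \<bar>\<psi> x - \<psi> y\<bar> * \<bar>u - v\<bar>"
    proof -
      have "\<bar>\<phi> (\<psi> x) - \<phi> (\<psi> y)\<bar> * \<bar>\<psi> u - \<psi> v\<bar> \<le> exp c * \<bar>\<phi> (\<psi> u) - \<phi> (\<psi> v)\<bar> * \<bar>\<psi> x - \<psi> y\<bar>"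
        using \<phi> S unfolding distort_def by blast
      from mult_right_mono[OF this, of "\<bar>u - v\<bar>"] show ?thesis by (simp add: mult_ac)
    qed
    also have "\<dots> = exp c * \<bar>\<phi> (\<psi> u) - \<phi> (\<psi> v)\<bar> * (\<bar>\<psi> x - \<psi> y\<bar> * \<bar>u - v\<bar>)" by simp
    also have "\<dots> \<le> exp c * \<bar>\<phi> (\<psi> u) - \<phi> (\<psi> v)\<bar> * (exp d * \<bar>\<psi> u - \<psi> v\<bar> * \<bar>x - y\<bar>)"
      using \<psi> S unfolding distort_def by (intro mult_left_mono) auto
    also have "\<dots> = (exp (c + d) * \<bar>\<phi> (\<psi> u) - \<phi> (\<psi> v)\<bar> * \<bar>x - y\<bar>) * \<bar>\<psi> u - \<psi> v\<bar>"
      by (simp add: exp_add mult_ac)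
    finally show ?thesis using pos by (simp add: mult_le_cancel_right)
  qed simp
qed

text \<open>
  For an inverse branch \<open>g\<close>, the mean value theorem supplies the slopes \<open>d\<close>: they are values of the
  derivative of the forward branch.
\<close>

lemma distort_if_slopes:
  assumes slope: "\<And>x y. x \<in> S \<Longrightarrow> y \<in> S \<Longrightarrow> x \<noteq> y \<Longrightarrow> \<exists>d\<in>D. \<bar>x - y\<bar> = d * \<bar>g x - g y\<bar>"
    and ratio: "\<And>d e. d \<in> D \<Longrightarrow> e \<in> D \<Longrightarrow> d \<le> exp c * e"
  shows "distort g S c"
  unfolding distort_def
proof (intro ballI)
  fix x y u v assume S: "x \<in> S" "y \<in> S" "u \<in> S" "v \<in> S"
  show "\<bar>g x - g y\<bar> * \<bar>u - v\<bar> \<le> exp c * \<bar>g u - g v\<bar> * \<bar>x - y\<bar>"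
  proof (cases "x = y \<or> u = v")
    case False
    then obtain d e where de: "d \<in> D" "\<bar>x - y\<bar> = d * \<bar>g x - g y\<bar>" "e \<in> D" "\<bar>u - v\<bar> = e * \<bar>g u - g v\<bar>"
      using slope S by meson
    have "e * (\<bar>g u - g v\<bar> * \<bar>g x - g y\<bar>) \<le> exp c * d * (\<bar>g u - g v\<bar> * \<bar>g x - g y\<bar>)"
      using ratio[OF de(3,1)] by (rule mult_right_mono) simp
    then show ?thesis unfolding de(2,4) by (simp add: mult_ac)
  qed auto
qed

section \<open>Inverse branches of an intermittent map\<close>

datatype side = L | R

text \<open>
  The parameters \<open>fl\<close> and \<open>fr\<close> are the branches extended to \<open>{0..r1}\<close> and \<open>{r1..1}\<close>. The second
  derivative of \<open>fl\<close> enters only through \<open>fl'_mono\<close> and \<open>fl'_osc\<close>. The latter says that on an interval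
  \<open>{a..b}\<close> whose endpoints are comparable, the mean value of the second derivative over a subinterval is
  at most \<open>C\<close> times its mean value over the whole interval; division is avoided.
\<close>

locale intermittent_branches =
  fixes fl fr fl' fr' :: "real \<Rightarrow> real" and r1 \<theta> C K :: real
  assumes r1: "0 < r1" "r1 < 1"
    and fl_deriv: "\<And>x. x \<in> {0..r1} \<Longrightarrow> (fl has_real_derivative fl' x) (at x within {0..r1})"
    and fl_ends: "fl 0 = 0" "fl r1 = 1"
    and fl'_mono: "\<And>x y. 0 \<le> x \<Longrightarrow> x \<le> y \<Longrightarrow> y \<le> r1 \<Longrightarrow> fl' x \<le> fl' y"
    and fl'_0: "1 \<le> fl' 0"
    and fl'_gt: "\<And>x. 0 < x \<Longrightarrow> x \<le> r1 \<Longrightarrow> 1 < fl' x"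
    and fl'_osc: "\<And>a b x y. 0 < a \<Longrightarrow> b * r1 \<le> a \<Longrightarrow> b \<le> r1 \<Longrightarrow> a \<le> x \<Longrightarrow> x \<le> y \<Longrightarrow> y \<le> b \<Longrightarrow>
           (fl' y - fl' x) * (b - a) \<le> C * (fl' b - fl' a) * (y - x)"
    and fr_deriv: "\<And>x. x \<in> {r1..1} \<Longrightarrow> (fr has_real_derivative fr' x) (at x within {r1..1})"
    and fr_ends: "{fr r1, fr 1} = {0, 1}"
    and fr'_lip: "\<And>x y. x \<in> {r1..1} \<Longrightarrow> y \<in> {r1..1} \<Longrightarrow> \<bar>fr' x - fr' y\<bar> \<le> K * \<bar>x - y\<bar>"
    and \<theta>: "0 < \<theta>" "\<theta> < 1"
    and fr'_ge: "\<And>x. x \<in> {r1..1} \<Longrightarrow> 1 \<le> \<theta> * \<bar>fr' x\<bar>"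
    and nonneg: "0 \<le> C" "0 \<le> K"
begin

definition gL where "gL = the_inv_into {0..r1} fl"
definition gR where "gR = the_inv_into {r1..1} fr"

lemma fl'_ge: "x \<in> {0..r1} \<Longrightarrow> 1 \<le> fl' x"
  using fl'_mono[of 0 x] fl'_0 by auto

lemma fl_cont: "continuous_on {0..r1} fl"
  by (rule DERIV_continuous_on[OF fl_deriv])

lemma fr_cont: "continuous_on {r1..1} fr"
  by (rule DERIV_continuous_on[OF fr_deriv])

lemma fl_mvt:
  assumes "0 \<le> x" "x < y" "y \<le> r1"
  obtains \<xi> where "x < \<xi>" "\<xi> < y" "fl y - fl x = fl' \<xi> * (y - x)"
proof (rule mvt_within[OF assms(2), of fl fl'])
  show "(fl has_real_derivative fl' t) (at t within {x..y})" if "t \<in> {x..y}" for t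
    using fl_deriv[of t] that assms by (auto intro: DERIV_subset)
qed (use that in blast)

lemma fr_mvt:
  assumes "r1 \<le> x" "x < y" "y \<le> 1"
  obtains \<xi> where "x < \<xi>" "\<xi> < y" "fr y - fr x = fr' \<xi> * (y - x)"
proof (rule mvt_within[OF assms(2), of fr fr'])
  show "(fr has_real_derivative fr' t) (at t within {x..y})" if "t \<in> {x..y}" for t
    using fr_deriv[of t] that assms by (auto intro: DERIV_subset)
qed (use that in blast)

lemma fl_expand: assumes "0 \<le> x" "x \<le> y" "y \<le> r1" shows "y - x \<le> fl y - fl x"
proof (cases "x = y")
  case False
  then obtain \<xi> where "x < \<xi>" "\<xi> < y" "fl y - fl x = fl' \<xi> * (y - x)"
    using fl_mvt[of x y] assms by auto
  then show ?thesis using fl'_ge[of \<xi>] assms mult_right_mono[of 1 "fl' \<xi>" "y - x"] by simp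
qed simp

lemma fl_inj: "inj_on fl {0..r1}"
proof (rule inj_onI)
  fix x y assume xy: "x \<in> {0..r1}" "y \<in> {0..r1}" "fl x = fl y"
  have "y - x \<le> 0" if "x \<le> y" using fl_expand[of x y] that xy by simp
  moreover have "x - y \<le> 0" if "y \<le> x" using fl_expand[of y x] that xy by simp
  ultimately show "x = y" by linarith
qed

lemma fl_image: "fl ` {0..r1} = {0..1}"
proof
  show "fl ` {0..r1} \<subseteq> {0..1}"
  proof (rule image_subsetI)
    fix x assume "x \<in> {0..r1}"
    then show "fl x \<in> {0..1}" using fl_expand[of 0 x] fl_expand[of x r1] fl_ends by simp
  qed
  show "{0..1} \<subseteq> fl ` {0..r1}"
  proof
    fix t :: real assume "t \<in> {0..1}"
    then show "t \<in> fl ` {0..r1}"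
      using IVT'[of fl 0 t r1] fl_cont fl_ends r1 by force
  qed
qed

lemma fr_expand: assumes "x \<in> {r1..1}" "y \<in> {r1..1}" shows "\<bar>x - y\<bar> \<le> \<theta> * \<bar>fr x - fr y\<bar>"
proof -
  have *: "y - x \<le> \<theta> * \<bar>fr y - fr x\<bar>" if xy: "r1 \<le> x" "x < y" "y \<le> 1" for x y
  proof -
    obtain \<xi> where "x < \<xi>" "\<xi> < y" "fr y - fr x = fr' \<xi> * (y - x)" using fr_mvt xy by blast
    then show ?thesis using fr'_ge[of \<xi>] xy mult_right_mono[of 1 "\<theta> * \<bar>fr' \<xi>\<bar>" "y - x"]
      by (simp add: abs_mult)
  qed
  show ?thesis using *[of x y] *[of y x] assms \<theta> by (cases x y rule: linorder_cases) (auto simp: abs_minus_commute)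
qed

lemma fr_inj: "inj_on fr {r1..1}"
proof (rule inj_onI)
  fix x y assume "x \<in> {r1..1}" "y \<in> {r1..1}" "fr x = fr y"
  then show "x = y" using fr_expand[of x y] by simp
qed

lemma fr_monotone: "strict_mono_on {r1..1} fr \<or> strict_antimono_on {r1..1} fr"
  using fr_inj injective_eq_monotone_map[OF _ fr_cont] by simp

lemma fr_cases:
  obtains (inc) "strict_mono_on {r1..1} fr" "fr r1 = 0" "fr 1 = 1"
  | (dec) "strict_antimono_on {r1..1} fr" "fr r1 = 1" "fr 1 = 0"
  using fr_monotone
proof
  assume m: "strict_mono_on {r1..1} fr"
  then have "fr r1 < fr 1" using r1 monotone_onD[OF m, of r1 1] by auto
  then show thesis using inc m fr_ends by (auto simp: doubleton_eq_iff)
next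
  assume m: "strict_antimono_on {r1..1} fr"
  then have "fr 1 < fr r1" using r1 monotone_onD[OF m, of r1 1] by auto
  then show thesis using dec m fr_ends by (auto simp: doubleton_eq_iff)
qed

lemma fr_image: "fr ` {r1..1} = {0..1}"
proof (cases rule: fr_cases)
  case inc
  have "fr x \<in> {0..1}" if "x \<in> {r1..1}" for x
    using monotone_onD[OF inc(1), of r1 x] monotone_onD[OF inc(1), of x 1] inc that r1
    by (cases "x = r1"; cases "x = 1") auto
  then have "fr ` {r1..1} \<subseteq> {0..1}" by blast
  moreover have "t \<in> fr ` {r1..1}" if "t \<in> {0..1}" for t
    using IVT'[of fr r1 t 1] fr_cont inc r1 that by force
  ultimately show ?thesis by blast
next
  case dec
  have "fr x \<in> {0..1}" if "x \<in> {r1..1}" for x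
    using monotone_onD[OF dec(1), of r1 x] monotone_onD[OF dec(1), of x 1] dec that r1
    by (cases "x = r1"; cases "x = 1") auto
  then have "fr ` {r1..1} \<subseteq> {0..1}" by blast
  moreover have "t \<in> fr ` {r1..1}" if "t \<in> {0..1}" for t
    using IVT2'[of fr 1 t r1] fr_cont dec r1 that by force
  ultimately show ?thesis by blast
qed

lemma gL: assumes "t \<in> {0..1}" shows "gL t \<in> {0..r1}" "fl (gL t) = t"
proof -
  have t: "t \<in> fl ` {0..r1}" using assms fl_image by simp
  show "gL t \<in> {0..r1}" unfolding gL_def by (rule the_inv_into_into[OF fl_inj t subset_refl])
  show "fl (gL t) = t" unfolding gL_def by (rule f_the_inv_into_f[OF fl_inj t])
qed

lemma gL_fl: "x \<in> {0..r1} \<Longrightarrow> gL (fl x) = x"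
  by (simp add: gL_def the_inv_into_f_f fl_inj)

lemma gR: assumes "t \<in> {0..1}" shows "gR t \<in> {r1..1}" "fr (gR t) = t"
proof -
  have t: "t \<in> fr ` {r1..1}" using assms fr_image by simp
  show "gR t \<in> {r1..1}" unfolding gR_def by (rule the_inv_into_into[OF fr_inj t subset_refl])
  show "fr (gR t) = t" unfolding gR_def by (rule f_the_inv_into_f[OF fr_inj t])
qed

lemma gR_fr: "x \<in> {r1..1} \<Longrightarrow> gR (fr x) = x"
  by (simp add: gR_def the_inv_into_f_f fr_inj)

lemma gL_ends: "gL 0 = 0" "gL 1 = r1"
proof -
  have "gL (fl 0) = 0" "gL (fl r1) = r1" using r1 by (auto intro: gL_fl)
  then show "gL 0 = 0" "gL 1 = r1" unfolding fl_ends .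
qed

lemma gL_diff:
  assumes "s \<in> {0..1}" "t \<in> {0..1}" "gL s \<le> gL t" shows "gL t - gL s \<le> t - s"
proof -
  have "gL t - gL s \<le> fl (gL t) - fl (gL s)"
    using gL(1)[OF assms(1)] gL(1)[OF assms(2)] assms(3) by (intro fl_expand) simp_all
  then show ?thesis unfolding gL(2)[OF assms(1)] gL(2)[OF assms(2)] .
qed

lemma gL_less: assumes "0 \<le> s" "s < t" "t \<le> 1" shows "gL s < gL t"
proof (rule ccontr)
  assume "\<not> ?thesis"
  then have "gL s - gL t \<le> s - t" "gL t \<le> gL s" using gL_diff[of t s] assms by auto
  then show False using assms by linarith
qed

lemma gL_le: assumes "0 \<le> s" "s \<le> t" "t \<le> 1" shows "gL s \<le> gL t"
  using gL_less[of s t] assms by (cases "s = t") auto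

lemma gL_contract: assumes "s \<in> {0..1}" "t \<in> {0..1}" shows "\<bar>gL s - gL t\<bar> \<le> \<bar>s - t\<bar>"
  using gL_diff[OF assms] gL_diff[OF assms(2,1)] by linarith

lemma gL_le_self: assumes "t \<in> {0..1}" shows "gL t \<le> t"
  using gL_diff[of 0 t] gL(1)[OF assms] gL_ends(1) assms by simp

lemma gR_contract: assumes "s \<in> {0..1}" "t \<in> {0..1}" shows "\<bar>gR s - gR t\<bar> \<le> \<theta> * \<bar>s - t\<bar>"
  using fr_expand[OF gR(1)[OF assms(1)] gR(1)[OF assms(2)]]
  unfolding gR(2)[OF assms(1)] gR(2)[OF assms(2)] .

text \<open>
  A concave function that vanishes at \<open>0\<close> has decreasing quotient \<open>gL t / t\<close>. This is how \<open>gL\<close> keeps the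
  points of a cylinder comparable in size, however close to \<open>0\<close> the cylinder lies.
\<close>

lemma gL_concave: assumes "0 \<le> x" "x \<le> y" "y \<le> 1" shows "gL y * x \<le> gL x * y"
proof -
  define p q where "p = gL x" and "q = gL y"
  have pq: "0 \<le> p" "p \<le> q" "q \<le> r1" "fl p = x" "fl q = y"
    using gL(1)[of x] gL(2)[of x] gL(1)[of y] gL(2)[of y] gL_le[of x y] assms
    unfolding p_def q_def by simp_all
  show ?thesis
  proof (cases "p = 0 \<or> p = q")
    case True
    then show ?thesis
    proof
      assume "p = 0"
      then have "x = 0" using pq(4) fl_ends by simp
      then show ?thesis using \<open>p = 0\<close> unfolding p_def by simp
    next
      assume "p = q"
      then have "x = y" using pq(4,5) by simp
      then show ?thesis by simp
    qed
  next
    case False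
    then have "0 < p" "p < q" using pq by auto
    obtain \<xi> where a: "0 < \<xi>" "\<xi> < p" "x = fl' \<xi> * p"
      using fl_mvt[of 0 p] \<open>0 < p\<close> pq fl_ends by auto
    obtain \<eta> where b: "p < \<eta>" "\<eta> < q" "y - x = fl' \<eta> * (q - p)"
      using fl_mvt[of p q] \<open>p < q\<close> pq by auto
    have "fl' \<xi> \<le> fl' \<eta>" using a b pq by (intro fl'_mono) auto
    then have "fl' \<xi> * ((q - p) * p) \<le> fl' \<eta> * ((q - p) * p)"
      using pq by (intro mult_right_mono) auto
    then have "x * (q - p) \<le> (y - x) * p" unfolding b(3) using a(3) by (simp add: mult_ac)
    then show ?thesis unfolding p_def[symmetric] q_def[symmetric] by (simp add: algebra_simps)
  qed
qed

text \<open>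
  Differences of \<open>fl'\<close> can replace differences of its logarithm, because \<open>fl' \<ge> 1\<close>.
\<close>

lemma distort_gL:
  assumes S: "S \<subseteq> {0..1}" and "0 \<le> c"
    and osc: "\<And>u v. u \<in> S \<Longrightarrow> v \<in> S \<Longrightarrow> fl' (gL u) - fl' (gL v) \<le> c"
  shows "distort gL S c"
proof (rule distort_if_slopes)
  \<comment> \<open>Monotonicity of fl' bounds its value at an intermediate point by its values at points
    of gL ` S, so that S itself need not be an interval.\<close>
  let ?D = "{d. 1 \<le> d \<and> (\<exists>u\<in>S. \<exists>v\<in>S. fl' (gL u) \<le> d \<and> d \<le> fl' (gL v))}"
  have *: "\<exists>d\<in>?D. y - x = d * (gL y - gL x)" if st: "x \<in> S" "y \<in> S" "x < y" for x y
  proof -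
    have xy: "x \<in> {0..1}" "y \<in> {0..1}" using st S by auto
    obtain \<xi> where \<xi>: "gL x < \<xi>" "\<xi> < gL y" "fl (gL y) - fl (gL x) = fl' \<xi> * (gL y - gL x)"
    proof (rule fl_mvt[of "gL x" "gL y"])
      show "gL x < gL y" using st xy by (intro gL_less) auto
    qed (use gL(1)[OF xy(1)] gL(1)[OF xy(2)] in auto)
    have "fl' (gL x) \<le> fl' \<xi>" "fl' \<xi> \<le> fl' (gL y)" "1 \<le> fl' \<xi>"
      using \<xi>(1,2) gL(1)[OF xy(1)] gL(1)[OF xy(2)] by (auto intro!: fl'_mono fl'_ge)
    then show ?thesis using \<xi>(3) that unfolding gL(2)[OF xy(1)] gL(2)[OF xy(2)] by blast
  qed
  show "\<exists>d\<in>?D. \<bar>x - y\<bar> = d * \<bar>gL x - gL y\<bar>" if xy: "x \<in> S" "y \<in> S" "x \<noteq> y" for x y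
  proof (cases "x < y")
    case True
    then have "gL x < gL y" using xy S by (intro gL_less) auto
    then show ?thesis using *[OF xy(1,2) True] True by (auto simp: abs_minus_commute)
  next
    case False
    then have "y < x" using xy by simp
    then have "gL y < gL x" using xy S by (intro gL_less) auto
    then show ?thesis using *[OF xy(2,1) \<open>y < x\<close>] \<open>y < x\<close> by auto
  qed
  show "d \<le> exp c * e" if "d \<in> ?D" "e \<in> ?D" for d e
    using that assms(2) osc by (intro le_exp_mult) (auto, smt (verit, best))
qed

lemma distort_gR:
  assumes S: "S \<subseteq> {0..1}" and diam: "\<And>u v. u \<in> S \<Longrightarrow> v \<in> S \<Longrightarrow> \<bar>u - v\<bar> \<le> \<rho>" and "0 \<le> \<rho>"
  shows "distort gR S (K * \<rho>)"
proof (rule distort_if_slopes)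
  let ?D = "{\<bar>fr' \<xi>\<bar> |\<xi>. \<exists>u\<in>S. \<exists>v\<in>S. gR u \<le> \<xi> \<and> \<xi> \<le> gR v}"
  have range: "gR u \<in> {r1..1}" if "u \<in> S" for u using gR(1) S that by blast
  have *: "\<exists>d\<in>?D. \<bar>x - y\<bar> = d * \<bar>gR x - gR y\<bar>" if st: "x \<in> S" "y \<in> S" "gR x < gR y" for x y
  proof -
    have xy: "x \<in> {0..1}" "y \<in> {0..1}" using that S by auto
    obtain \<xi> where \<xi>: "gR x < \<xi>" "\<xi> < gR y" "fr (gR y) - fr (gR x) = fr' \<xi> * (gR y - gR x)"
      by (rule fr_mvt[of "gR x" "gR y"]) (use st range[of x] range[of y] in auto)
    have "\<bar>y - x\<bar> = \<bar>fr' \<xi>\<bar> * \<bar>gR y - gR x\<bar>"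
      using \<xi>(3) unfolding gR(2)[OF xy(1)] gR(2)[OF xy(2)] by (simp add: abs_mult)
    moreover have "\<bar>fr' \<xi>\<bar> \<in> ?D" using \<xi> that by (force intro: less_imp_le)
    ultimately show ?thesis by (auto simp: abs_minus_commute)
  qed
  show "\<exists>d\<in>?D. \<bar>x - y\<bar> = d * \<bar>gR x - gR y\<bar>" if xy: "x \<in> S" "y \<in> S" "x \<noteq> y" for x y
  proof -
    have "x \<in> {0..1}" "y \<in> {0..1}" using xy S by auto
    then have "gR x \<noteq> gR y" using gR(2)[of x] gR(2)[of y] xy(3) by auto
    then consider "gR x < gR y" | "gR y < gR x" by linarith
    then show ?thesis
    proof cases
      case 1 then show ?thesis using *[OF xy(1,2)] by simp
    next
      case 2 then show ?thesis using *[OF xy(2,1)] by (simp add: abs_minus_commute)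
    qed
  qed
  show "d \<le> exp (K * \<rho>) * e" if de: "d \<in> ?D" "e \<in> ?D" for d e
  proof -
    obtain \<xi> u v where \<xi>: "d = \<bar>fr' \<xi>\<bar>" "u \<in> S" "v \<in> S" "gR u \<le> \<xi>" "\<xi> \<le> gR v" using de(1) by auto
    obtain \<eta> u' v' where \<eta>: "e = \<bar>fr' \<eta>\<bar>" "u' \<in> S" "v' \<in> S" "gR u' \<le> \<eta>" "\<eta> \<le> gR v'" using de(2) by auto
    have close: "\<bar>gR s - gR t\<bar> \<le> \<rho>" if "s \<in> S" "t \<in> S" for s t
    proof -
      have "\<bar>gR s - gR t\<bar> \<le> \<theta> * \<bar>s - t\<bar>" using that S by (intro gR_contract) auto
      also have "\<dots> \<le> \<bar>s - t\<bar>" using \<theta> by (intro mult_left_le_one_le) auto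
      finally show ?thesis using diam[OF that] by linarith
    qed
    have "\<bar>\<xi> - \<eta>\<bar> \<le> \<rho>"
      using close[OF \<xi>(3) \<eta>(2)] close[OF \<eta>(3) \<xi>(2)] \<xi>(4,5) \<eta>(4,5) by linarith
    then have "K * \<bar>\<xi> - \<eta>\<bar> \<le> K * \<rho>" using nonneg by (intro mult_left_mono)
    moreover have in_range: "\<xi> \<in> {r1..1}" "\<eta> \<in> {r1..1}"
      using range[OF \<xi>(2)] range[OF \<xi>(3)] range[OF \<eta>(2)] range[OF \<eta>(3)] \<xi>(4,5) \<eta>(4,5) by auto
    ultimately have "d \<le> e + K * \<rho>" using fr'_lip[OF in_range] unfolding \<xi>(1) \<eta>(1) by linarith
    moreover have "\<theta> * \<bar>fr' \<eta>\<bar> \<le> \<bar>fr' \<eta>\<bar>" using \<theta> by (intro mult_left_le_one_le) auto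
    then have "1 \<le> e" unfolding \<eta>(1) using fr'_ge[OF in_range(2)] by linarith
    ultimately show ?thesis using nonneg \<open>0 \<le> \<rho>\<close> by (intro le_exp_mult) auto
  qed
qed

section \<open>Composed inverse branches\<close>

primrec branch :: "side \<Rightarrow> real \<Rightarrow> real" where
  "branch L = gL" | "branch R = gR"

abbreviation pull :: "side list \<Rightarrow> real \<Rightarrow> real" where "pull w \<equiv> foldr branch w"

lemma branch_in: "t \<in> {0..1} \<Longrightarrow> branch b t \<in> {0..1}"
  using gL(1)[of t] gR(1)[of t] r1 by (cases b) auto

lemma pull_in: "t \<in> {0..1} \<Longrightarrow> pull w t \<in> {0..1}"
  by (induction w) (use branch_in in auto)

lemma gR_monotone: "strict_mono_on {0..1} gR \<or> strict_antimono_on {0..1} gR"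
proof (cases rule: fr_cases)
  case inc
  have "gR s < gR t" if st: "s \<in> {0..1}" "t \<in> {0..1}" "s < t" for s t
  proof (rule ccontr)
    assume "\<not> ?thesis"
    then have "fr (gR t) \<le> fr (gR s)"
      using monotone_onD[OF inc(1) gR(1)[OF st(2)] gR(1)[OF st(1)]] by (cases "gR t = gR s") auto
    then show False using st(3) unfolding gR(2)[OF st(1)] gR(2)[OF st(2)] by simp
  qed
  then show ?thesis by (auto simp: monotone_on_def)
next
  case dec
  have "gR t < gR s" if st: "s \<in> {0..1}" "t \<in> {0..1}" "s < t" for s t
  proof (rule ccontr)
    assume "\<not> ?thesis"
    then have "fr (gR t) \<le> fr (gR s)"
      using monotone_onD[OF dec(1) gR(1)[OF st(1)] gR(1)[OF st(2)]] by (cases "gR t = gR s") auto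
    then show False using st(3) unfolding gR(2)[OF st(1)] gR(2)[OF st(2)] by simp
  qed
  then show ?thesis by (auto simp: monotone_on_def)
qed

lemma branch_monotone: "strict_mono_on {0..1} (branch b) \<or> strict_antimono_on {0..1} (branch b)"
  using gR_monotone gL_less by (cases b) (auto simp: monotone_on_def)

lemma pull_monotone: "strict_mono_on {0..1} (pull w) \<or> strict_antimono_on {0..1} (pull w)"
proof (induction w)
  case (Cons b w)
  then show ?case using branch_monotone[of b] pull_in[of _ w]
    by (auto simp: monotone_on_def)
qed (auto simp: monotone_on_def)

lemma pull_inj: "inj_on (pull w) {0..1}"
proof (rule inj_onI)
  fix x y assume xy: "x \<in> {0..1}" "y \<in> {0..1}" "pull w x = pull w y"
  have "\<not> x < y" if "x \<in> {0..1}" "y \<in> {0..1}" "pull w x = pull w y" for x y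
    using pull_monotone[of w] monotone_onD[of "{0..1}" "(<)" _ "pull w" x y] that by fastforce
  from this[OF xy] this[OF xy(2,1) xy(3)[symmetric]] show "x = y" by simp
qed

definition width :: "side list \<Rightarrow> real" where "width w = \<bar>pull w 1 - pull w 0\<bar>"

lemma pull_nest:
  assumes "0 \<le> a" "b \<le> 1" "x \<in> {a..b}" "y \<in> {a..b}"
  shows "\<bar>pull w x - pull w y\<bar> \<le> \<bar>pull w b - pull w a\<bar>"
  using pull_monotone[of w]
proof
  assume m: "strict_mono_on {0..1} (pull w)"
  have "pull w s \<le> pull w t" if "a \<le> s" "s \<le> t" "t \<le> b" for s t
    using monotone_onD[OF m, of s t] that assms by (cases "s = t") auto
  from this[of a x] this[of a y] this[of x b] this[of y b] show ?thesis using assms(3,4) by auto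
next
  assume m: "strict_antimono_on {0..1} (pull w)"
  have "pull w t \<le> pull w s" if "a \<le> s" "s \<le> t" "t \<le> b" for s t
    using monotone_onD[OF m, of s t] that assms by (cases "s = t") auto
  from this[of a x] this[of a y] this[of x b] this[of y b] show ?thesis using assms(3,4) by auto
qed

lemma pull_diam: "x \<in> {0..1} \<Longrightarrow> y \<in> {0..1} \<Longrightarrow> \<bar>pull w x - pull w y\<bar> \<le> width w"
  unfolding width_def by (rule pull_nest) auto

lemma width_pos: "0 < width w"
  using inj_onD[OF pull_inj[of w], of 1 0] by (auto simp: width_def)

lemma width_le_1: "width w \<le> 1"
  using pull_in[of 0 w] pull_in[of 1 w] by (auto simp: width_def)

lemma width_L: "width (L # w) \<le> width w"
  using gL_contract[of "pull w 1" "pull w 0"] pull_in by (simp add: width_def)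

lemma width_R: "width (R # w) \<le> \<theta> * width w"
  using gR_contract[of "pull w 1" "pull w 0"] pull_in by (simp add: width_def)

text \<open>
  Letters are added at the front, that is, as outermost maps; these contract.
\<close>

lemma width_append_le: "width (v @ w) \<le> width w"
proof (induction v)
  case (Cons b v)
  have "\<theta> * width (v @ w) \<le> width (v @ w)"
    using \<theta> width_pos[of "v @ w"] by (intro mult_left_le_one_le) auto
  then show ?case using Cons width_L[of "v @ w"] width_R[of "v @ w"] by (cases b) auto
qed simp

lemma gR_ends: "{gR 0, gR 1} = {r1, 1}"
proof -
  have "gR (fr r1) = r1" "gR (fr 1) = 1" using r1 by (auto intro: gR_fr)
  then show ?thesis using fr_ends by (auto simp: doubleton_eq_iff)
qed

text \<open>
  All points of a cylinder whose word contains \<open>R\<close> are comparable: this is clear for the cylinders inside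
  \<open>{r1..1}\<close>, and \<open>gL\<close> does not increase the ratio of two points by concavity.
\<close>

lemma pull_ratio:
  assumes "R \<in> set u" "x \<in> {0..1}" "y \<in> {0..1}"
  shows "pull u y * r1 \<le> pull u x \<and> 0 < pull u x"
  using assms
proof (induction u arbitrary: x y)
  case (Cons b u)
  note xy = Cons.prems(2,3)
  show ?case
  proof (cases b)
    case R
    have le: "gR (pull u y) \<le> 1" "r1 \<le> gR (pull u x)" using gR(1)[OF pull_in] xy by auto
    have "gR (pull u y) * r1 \<le> 1 * r1" using le(1) r1 by (intro mult_right_mono) auto
    then have "gR (pull u y) * r1 \<le> gR (pull u x)" using le(2) by linarith
    then show ?thesis using R r1 le(2) by auto
  next
    case L
    define x' y' where "x' = pull u x" and "y' = pull u y"
    have "R \<in> set u" using Cons.prems L by auto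
    then have IH: "y' * r1 \<le> x'" "0 < x'" "0 < y'" using Cons.IH xy by (auto simp: x'_def y'_def)
    have in01: "x' \<in> {0..1}" "y' \<in> {0..1}" using xy pull_in by (auto simp: x'_def y'_def)
    have pos: "0 < gL x'" "0 < gL y'" using gL_less[of 0 x'] gL_less[of 0 y'] gL_ends in01 IH by auto
    show ?thesis
    proof (cases "y' \<le> x'")
      case True
      then have "gL y' \<le> gL x'" using in01 by (intro gL_le) auto
      moreover have "gL y' * r1 \<le> gL y'" using pos r1 by (simp add: mult_left_le)
      ultimately have "gL y' * r1 \<le> gL x'" by linarith
      then show ?thesis using pos L by (simp add: x'_def y'_def)
    next
      case False
      have "gL y' * r1 * x' = (gL y' * x') * r1" by simp
      also have "\<dots> \<le> (gL x' * y') * r1"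
        using gL_concave[of x' y'] False in01 r1 by (intro mult_right_mono) auto
      also have "\<dots> = gL x' * (y' * r1)" by simp
      also have "\<dots> \<le> gL x' * x'" using IH pos by (intro mult_left_mono) auto
      finally show ?thesis using IH pos L by (simp add: x'_def y'_def)
    qed
  qed
qed auto

section \<open>Bounded distortion of the returning branches\<close>

text \<open>
  A block is the itinerary of a point between two consecutive levels: \<open>k\<close> steps of the left branch bring
  it to \<open>{r1..1}\<close>, from where the right branch takes it to an arbitrary point of \<open>{0..1}\<close>.
\<close>

abbreviation block :: "nat \<Rightarrow> side list" where "block k \<equiv> replicate k L @ [R]"

definition level :: "nat \<Rightarrow> real" where "level k = (gL ^^ k) 1"

lemma level_simps: "level 0 = 1" "level (Suc 0) = r1" "level (Suc k) = gL (level k)"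
  by (auto simp: level_def gL_ends)

lemma level_bounds: "0 < level k" "level k \<le> 1"
proof -
  have "0 < level k \<and> level k \<le> 1" for k
  proof (induction k)
    case (Suc k)
    then show ?case using gL_less[of 0 "level k"] gL_ends(1) gL_le_self[of "level k"] by (auto simp: level_simps(3))
  qed (simp add: level_simps)
  then show "0 < level k" "level k \<le> 1" by auto
qed

lemma level_decr: "level (Suc k) < level k"
proof (induction k)
  case (Suc k)
  then show ?case using gL_less[of "level (Suc k)" "level k"] level_bounds(1)[of "Suc k"] level_bounds(2)[of k]
    unfolding level_simps(3)[of "Suc k"] by (simp add: level_simps(3)[of k])
qed (use r1 in \<open>simp add: level_simps(1,2)\<close>)

lemma block_ends: "{pull (block k) 0, pull (block k) 1} = {level (Suc k), level k}"
proof (induction k)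
  case 0 then show ?case using gR_ends by (simp add: level_simps(1,2))
next
  case (Suc k)
  have "{pull (block (Suc k)) 0, pull (block (Suc k)) 1} = gL ` {pull (block k) 0, pull (block k) 1}"
    by simp
  also have "\<dots> = {level (Suc (Suc k)), level (Suc k)}"
    unfolding Suc.IH by (simp add: level_simps(3))
  finally show ?case .
qed

lemma block_width: "width (block k) = level k - level (Suc k)"
  using block_ends[of k] level_decr[of k] unfolding width_def by (auto simp: doubleton_eq_iff)

lemma block_range: assumes "t \<in> {0..1}" shows "pull (block k) t \<in> {level (Suc k)..level k}"
proof -
  have "\<bar>pull (block k) t - pull (block k) 0\<bar> \<le> width (block k)"
       "\<bar>pull (block k) t - pull (block k) 1\<bar> \<le> width (block k)"
    by (rule pull_diam; use assms in simp)+
  then show ?thesis using block_ends[of k] level_decr[of k]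
    unfolding block_width by (auto simp: doubleton_eq_iff)
qed

lemma level_ratio: "level k * r1 \<le> level (Suc k)"
  using block_ends[of k] pull_ratio[of "block k" 0 1] pull_ratio[of "block k" 1 0]
  by (auto simp: doubleton_eq_iff)

lemma level_le_r1: "level (Suc k) \<le> r1"
  using gL(1)[of "level k"] level_bounds[of k] by (simp add: level_simps(3))

lemma gL_block_range: assumes "t \<in> {0..1}" shows "gL (pull (block k) t) \<in> {level (Suc (Suc k))..level (Suc k)}"
  using block_range[OF assms, of "Suc k"] by simp

text \<open>
  Each application of \<open>gL\<close> contributes the increment of \<open>fl'\<close> between two consecutive levels, and the sum
  telescopes. The bound is therefore uniform in \<open>k\<close>, although \<open>fl'\<close> tends to \<open>1\<close> at the fixed point.
\<close>

lemma block_distort_coarse: "distort (pull (block k)) {0..1} (K + (fl' r1 - fl' (level (Suc k))))"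
proof (induction k)
  case 0
  have "distort gR {0..1} (K * 1)" by (rule distort_gR) auto
  then show ?case by (simp add: level_simps(2))
next
  case (Suc k)
  have in01: "pull (block k) ` {0..1} \<subseteq> {0..1}" by (intro image_subsetI pull_in)
  have "distort gL (pull (block k) ` {0..1}) (fl' (level (Suc k)) - fl' (level (Suc (Suc k))))"
  proof (rule distort_gL[OF in01])
    show "0 \<le> fl' (level (Suc k)) - fl' (level (Suc (Suc k)))"
      using fl'_mono[of "level (Suc (Suc k))" "level (Suc k)"] level_decr[of "Suc k"]
        level_bounds[of "Suc (Suc k)"] level_le_r1 by auto
    fix u v assume "u \<in> pull (block k) ` {0..1}" "v \<in> pull (block k) ` {0..1}"
    then have uv: "gL u \<in> {level (Suc (Suc k))..level (Suc k)}" "gL v \<in> {level (Suc (Suc k))..level (Suc k)}"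
      using gL_block_range by blast+
    have "fl' (gL u) \<le> fl' (level (Suc k))" "fl' (level (Suc (Suc k))) \<le> fl' (gL v)"
      using uv level_bounds[of "Suc (Suc k)"] level_le_r1[of k] by (auto intro!: fl'_mono)
    then show "fl' (gL u) - fl' (gL v) \<le> fl' (level (Suc k)) - fl' (level (Suc (Suc k)))" by linarith
  qed
  from distort_comp[OF this Suc.IH pull_inj] show ?case by (simp add: o_def algebra_simps)
qed

lemma fl'_level_nonneg: "0 \<le> fl' (level (Suc k))"
  using fl'_ge[of "level (Suc k)"] level_bounds[of "Suc k"] level_le_r1[of k] by simp

definition osc_bound where "osc_bound = C * exp (K + fl' r1)"

lemma osc_bound_nonneg: "0 \<le> osc_bound" using nonneg by (simp add: osc_bound_def)

text \<open>
  By the coarse bound, each intermediate image of \<open>S\<close> occupies at most a multiple of \<open>\<rho>\<close> of the interval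
  between two consecutive levels. By \<open>fl'_osc\<close> its share of the increment of \<open>fl'\<close> is then at most a
  multiple of \<open>\<rho>\<close> too, and the sum telescopes as before. The factor \<open>\<rho>\<close> makes the bounds for successive
  blocks summable.
\<close>

lemma block_distort_fine:
  assumes S: "S \<subseteq> {0..1}" and diam: "\<And>u v. u \<in> S \<Longrightarrow> v \<in> S \<Longrightarrow> \<bar>u - v\<bar> \<le> \<rho>" and "0 \<le> \<rho>"
  shows "distort (pull (block k)) S ((K + osc_bound * (fl' r1 - fl' (level (Suc k)))) * \<rho>)"
proof (induction k)
  case 0
  have "distort gR S (K * \<rho>)" using assms by (rule distort_gR)
  then show ?case by (simp add: level_simps(2))
next
  case (Suc k)
  let ?a = "level (Suc (Suc k))" and ?b = "level (Suc k)"
  have in01: "pull (block k) ` S \<subseteq> {0..1}" using S by (intro image_subsetI pull_in) auto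
  have a: "0 < ?a" "?a < ?b" "?b * r1 \<le> ?a" "?b \<le> r1"
    using level_bounds(1) level_decr level_ratio level_le_r1 by blast+
  have "distort gL (pull (block k) ` S) (osc_bound * (fl' ?b - fl' ?a) * \<rho>)"
  proof (rule distort_gL[OF in01])
    have "fl' ?a \<le> fl' ?b" using a by (intro fl'_mono) auto
    then show nn: "0 \<le> osc_bound * (fl' ?b - fl' ?a) * \<rho>" using osc_bound_nonneg \<open>0 \<le> \<rho>\<close> by simp
    fix u v assume "u \<in> pull (block k) ` S" "v \<in> pull (block k) ` S"
    then obtain x y where xy: "x \<in> S" "y \<in> S" "u = pull (block k) x" "v = pull (block k) y" by auto
    then have xy01: "x \<in> {0..1}" "y \<in> {0..1}" using S by auto
    have uv: "gL u \<in> {?a..?b}" "gL v \<in> {?a..?b}"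
      using gL_block_range xy01 unfolding xy by blast+
    show "fl' (gL u) - fl' (gL v) \<le> osc_bound * (fl' ?b - fl' ?a) * \<rho>"
    proof (cases "gL u \<le> gL v")
      case True
      then have "fl' (gL u) \<le> fl' (gL v)" using uv a by (intro fl'_mono) auto
      then show ?thesis using nn by linarith
    next
      case False
      have "distort (pull (block (Suc k))) {0..1} (K + (fl' r1 - fl' ?a))"
        by (rule block_distort_coarse)
      then have "distort (pull (block (Suc k))) {0..1} (K + fl' r1)"
        by (rule distort_mono) (use fl'_level_nonneg in auto)
      then have "\<bar>pull (block (Suc k)) x - pull (block (Suc k)) y\<bar> * \<bar>1 - 0\<bar>
          \<le> exp (K + fl' r1) * \<bar>pull (block (Suc k)) 1 - pull (block (Suc k)) 0\<bar> * \<bar>x - y\<bar>"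
        using xy01 unfolding distort_def by (meson atLeastAtMost_iff order_refl zero_le_one)
      also have "\<dots> \<le> exp (K + fl' r1) * width (block (Suc k)) * \<rho>"
        unfolding width_def using diam[OF xy(1,2)] by (intro mult_left_mono) auto
      finally have close: "gL u - gL v \<le> exp (K + fl' r1) * (?b - ?a) * \<rho>"
        unfolding block_width xy by simp
      have "(fl' (gL u) - fl' (gL v)) * (?b - ?a) \<le> C * (fl' ?b - fl' ?a) * (gL u - gL v)"
        using False uv a by (intro fl'_osc) auto
      also have "\<dots> \<le> C * (fl' ?b - fl' ?a) * (exp (K + fl' r1) * (?b - ?a) * \<rho>)"
        using nonneg \<open>fl' ?a \<le> fl' ?b\<close> by (intro mult_left_mono close) auto
      also have "\<dots> = (osc_bound * (fl' ?b - fl' ?a) * \<rho>) * (?b - ?a)" by (simp add: osc_bound_def)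
      finally show ?thesis using a(2) by (simp add: mult_le_cancel_right)
    qed
  qed
  moreover have "inj_on (pull (block k)) S" using pull_inj S by (rule inj_on_subset)
  ultimately have "distort (\<lambda>x. gL (pull (block k) x)) S
      (osc_bound * (fl' ?b - fl' ?a) * \<rho> + (K + osc_bound * (fl' r1 - fl' ?b)) * \<rho>)"
    by (intro distort_comp Suc.IH)
  moreover have "(\<lambda>x. gL (pull (block k) x)) = pull (block (Suc k))" by (simp add: fun_eq_iff)
  ultimately show ?case by (simp only:) (erule distort_mono, simp_all add: algebra_simps)
qed

text \<open>
  Words made up of complete blocks: after such an itinerary the point has just left \<open>{r1..1}\<close> through the
  right branch. The empty word serves as base case.
\<close>

definition returning :: "side list \<Rightarrow> bool" where "returning w \<longleftrightarrow> w = [] \<or> last w = R"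

lemma returning_cases:
  assumes "returning w" "w \<noteq> []"
  obtains k v where "w = block k @ v" "returning v"
proof -
  have "R \<in> set w" using assms last_in_set by (fastforce simp: returning_def)
  then obtain us v where w: "w = us @ R # v" "R \<notin> set us" by (meson split_list_first)
  have "us = replicate (length us) L"
    using w(2) side.exhaust by (intro replicate_length_same[symmetric]) metis
  then have "w = block (length us) @ v" using w(1) by simp
  moreover have "returning v" using assms w by (auto simp: returning_def split: if_splits)
  ultimately show thesis using that by blast
qed

lemma width_block: "width (block k @ v) \<le> \<theta> * width v"
proof -
  have "width (block k @ v) \<le> width (R # v)" using width_append_le[of "replicate k L" "R # v"] by simp
  then show ?thesis using width_R[of v] by linarith
qed

definition block_bound where "block_bound = K + osc_bound * fl' r1"

lemma block_bound_nonneg: "0 \<le> block_bound"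
  using nonneg osc_bound_nonneg fl'_ge[of r1] r1 by (simp add: block_bound_def)

text \<open>
  A block placed in front of \<open>v\<close> adds at most \<open>block_bound * width v\<close> and multiplies the width by a factor
  of at most \<open>\<theta>\<close>. The bound is chosen so that the geometric series telescopes along the induction.
\<close>

lemma returning_distort:
  assumes "returning w"
  shows "distort (pull w) {0..1} (block_bound / (1 - \<theta>) * (1 - width w))"
  using assms
proof (induction "length w" arbitrary: w rule: less_induct)
  case less
  show ?case
  proof (cases "w = []")
    case True
    then show ?thesis using distort_id[of "{0..1}"] by (simp add: width_def id_def)
  next
    case False
    then obtain k v where w: "w = block k @ v" "returning v" using less.prems returning_cases by blast
    have IH: "distort (pull v) {0..1} (block_bound / (1 - \<theta>) * (1 - width v))"
      using w by (intro less.hyps) auto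
    have "distort (pull (block k)) (pull v ` {0..1}) ((K + osc_bound * (fl' r1 - fl' (level (Suc k)))) * width v)"
      by (rule block_distort_fine) (use pull_in pull_diam width_pos[of v] in \<open>auto simp: less_imp_le\<close>)
    then have "distort (pull (block k)) (pull v ` {0..1}) (block_bound * width v)"
    proof (rule distort_mono)
      have "osc_bound * (fl' r1 - fl' (level (Suc k))) \<le> osc_bound * fl' r1"
        using osc_bound_nonneg fl'_level_nonneg by (intro mult_left_mono) auto
      then show "(K + osc_bound * (fl' r1 - fl' (level (Suc k)))) * width v \<le> block_bound * width v"
        using width_pos[of v] unfolding block_bound_def by (intro mult_right_mono) auto
    qed simp
    from distort_comp[OF this IH pull_inj]
    have "distort (\<lambda>x. pull (block k) (pull v x)) {0..1}
        (block_bound * width v + block_bound / (1 - \<theta>) * (1 - width v))" .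
    moreover have "(\<lambda>x. pull (block k) (pull v x)) = pull w" by (simp add: w(1) fun_eq_iff)
    ultimately have "distort (pull w) {0..1} (block_bound * width v + block_bound / (1 - \<theta>) * (1 - width v))" by simp
    then show ?thesis
    proof (rule distort_mono)
      have "block_bound * width v + block_bound / (1 - \<theta>) * (1 - width v) = block_bound / (1 - \<theta>) * (1 - \<theta> * width v)"
        using \<theta> by (simp add: field_simps)
      also have "\<dots> \<le> block_bound / (1 - \<theta>) * (1 - width w)"
        using block_bound_nonneg \<theta> width_block[of k v] w by (intro mult_left_mono) auto
      finally show "block_bound * width v + block_bound / (1 - \<theta>) * (1 - width v) \<le> block_bound / (1 - \<theta>) * (1 - width w)" .
    qed simp
  qed
qed

definition dist_bound where "dist_bound = exp (block_bound / (1 - \<theta>))"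

lemma dist_bound_ge_1: "1 \<le> dist_bound" using block_bound_nonneg \<theta> by (simp add: dist_bound_def)

lemma returning_similar:
  assumes "returning w" "s \<in> {0..1}" "t \<in> {0..1}"
  shows "\<bar>pull w s - pull w t\<bar> \<le> dist_bound * width w * \<bar>s - t\<bar>"
    and "width w * \<bar>s - t\<bar> \<le> dist_bound * \<bar>pull w s - pull w t\<bar>"
proof -
  have "block_bound / (1 - \<theta>) * (1 - width w) \<le> block_bound / (1 - \<theta>)"
    using block_bound_nonneg \<theta> width_pos[of w] by (intro mult_right_le_one_le) (auto intro: width_le_1)
  then have "distort (pull w) {0..1} (block_bound / (1 - \<theta>))"
    by (rule distort_mono[OF returning_distort[OF assms(1)]]) simp
  then have *: "\<bar>pull w x - pull w y\<bar> * \<bar>u - v\<bar> \<le> dist_bound * \<bar>pull w u - pull w v\<bar> * \<bar>x - y\<bar>"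
    if "x \<in> {0..1}" "y \<in> {0..1}" "u \<in> {0..1}" "v \<in> {0..1}" for x y u v
    using that unfolding distort_def dist_bound_def by blast
  show "\<bar>pull w s - pull w t\<bar> \<le> dist_bound * width w * \<bar>s - t\<bar>"
    using *[of s t 1 0] assms by (simp add: width_def)
  show "width w * \<bar>s - t\<bar> \<le> dist_bound * \<bar>pull w s - pull w t\<bar>"
    using *[of 1 0 s t] assms by (simp add: width_def)
qed

section \<open>Separation of the preimages of zero\<close>

text \<open>
  In the coordinate of \<open>w\<close>, the points compared are \<open>0\<close> and \<open>pull u 0\<close>, and the cylinder of \<open>u\<close> has width
  at most \<open>pull u 0 / r1\<close> by \<open>pull_ratio\<close>. Bounded distortion of \<open>pull w\<close> transports this comparison.
\<close>

lemma nested_separated: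
  assumes w: "returning w" and u: "R \<in> set u"
  shows "r1 / dist_bound\<^sup>2 * width (w @ u) \<le> \<bar>pull w 0 - pull (w @ u) 0\<bar>"
proof -
  have in01: "pull u 0 \<in> {0..1}" "pull u 1 \<in> {0..1}" by (rule pull_in; simp)+
  have dist_bound: "0 < dist_bound" using dist_bound_ge_1 by linarith
  have "width u * r1 \<le> pull u 0"
  proof (cases "pull u 0 \<le> pull u 1")
    case True
    then have "width u * r1 \<le> pull u 1 * r1"
      using in01 r1 unfolding width_def by (intro mult_right_mono) auto
    also have "\<dots> \<le> pull u 0" using pull_ratio[OF u, of 0 1] by simp
    finally show ?thesis .
  next
    case False
    then have "width u \<le> pull u 0" using in01 by (auto simp: width_def)
    moreover have "width u * r1 \<le> width u" using r1 width_pos[of u] by (simp add: mult_left_le)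
    ultimately show ?thesis by linarith
  qed
  then have "width w * (width u * r1) \<le> width w * \<bar>0 - pull u 0\<bar>"
    using width_pos[of w] in01 by (intro mult_left_mono) auto
  also have "\<dots> \<le> dist_bound * \<bar>pull w 0 - pull (w @ u) 0\<bar>"
    using returning_similar(2)[OF w, of 0 "pull u 0"] in01 by simp
  finally have lower: "width w * (width u * r1) \<le> dist_bound * \<bar>pull w 0 - pull (w @ u) 0\<bar>" .
  have "width (w @ u) * r1 \<le> (dist_bound * width w * width u) * r1"
    using returning_similar(1)[OF w in01(2,1)] r1 by (intro mult_right_mono) (auto simp: width_def)
  also have "\<dots> \<le> dist_bound * (dist_bound * \<bar>pull w 0 - pull (w @ u) 0\<bar>)"
    using mult_left_mono[OF lower, of dist_bound] dist_bound by (simp add: mult_ac)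
  finally show ?thesis using dist_bound by (simp add: field_simps power2_eq_square)
qed

lemma pull_replicate: "pull (replicate m L) t = (gL ^^ m) t"
  by (induction m) auto

lemma gL_funpow_in: "t \<in> {0..1} \<Longrightarrow> (gL ^^ m) t \<in> {0..1}"
  using pull_in[of t "replicate m L"] by (simp only: pull_replicate)

lemma returning_prefix:
  obtains v m where "w = v @ replicate m L" "returning v"
proof (induction w arbitrary: thesis rule: rev_induct)
  case Nil
  then show ?case using Nil[of "[]" 0] by (simp add: returning_def)
next
  case (snoc b w)
  show ?case
  proof (cases b)
    case R
    then show ?thesis using snoc.prems[of "w @ [b]" 0] by (simp add: returning_def)
  next
    case L
    obtain v m where "w = v @ replicate m L" "returning v" using snoc.IH by blast
    then show ?thesis using snoc.prems[of v "Suc m"] L by (simp add: replicate_append_same)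
  qed
qed

text \<open>
  The cylinder of \<open>u\<close> lies between two consecutive levels, say \<open>level (k + 1)\<close> and \<open>level k\<close>. Its image
  under \<open>gL ^^ m\<close> then lies in the image under \<open>gL ^^ k\<close> of the interval on the right-hand side, and \<open>gL\<close>
  contracts.
\<close>

lemma level_width_le:
  assumes "returning u" "u \<noteq> []" "a \<in> {0..1}" "b \<in> {0..1}"
  shows "\<bar>(gL ^^ m) (pull u a) - (gL ^^ m) (pull u b)\<bar> \<le> \<bar>(gL ^^ m) 1 - (gL ^^ m) r1\<bar>"
  using assms
proof (induction u arbitrary: m)
  case (Cons s u)
  have in01: "pull u a \<in> {0..1}" "pull u b \<in> {0..1}" using Cons.prems pull_in by auto
  show ?case
  proof (cases s)
    case R
    have "gR (pull u a) \<in> {r1..1}" "gR (pull u b) \<in> {r1..1}" using gR(1) in01 by auto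
    then show ?thesis using pull_nest[of r1 1 _ _ "replicate m L"] R r1 by (simp add: pull_replicate)
  next
    case L
    then have u: "returning u" "u \<noteq> []" using Cons.prems by (auto simp: returning_def split: if_splits)
    have "\<bar>(gL ^^ m) (gL (pull u a)) - (gL ^^ m) (gL (pull u b))\<bar>
        = \<bar>gL ((gL ^^ m) (pull u a)) - gL ((gL ^^ m) (pull u b))\<bar>"
      by (simp add: funpow_swap1)
    also have "\<dots> \<le> \<bar>(gL ^^ m) (pull u a) - (gL ^^ m) (pull u b)\<bar>"
      using in01 by (intro gL_contract gL_funpow_in) auto
    also have "\<dots> \<le> \<bar>(gL ^^ m) 1 - (gL ^^ m) r1\<bar>" using Cons.IH u Cons.prems by blast
    finally show ?thesis using L by simp
  qed
qed simp

definition \<kappa> where "\<kappa> = r1 / dist_bound\<^sup>2"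

lemma \<kappa>: "0 < \<kappa>" "\<kappa> \<le> 1 / dist_bound\<^sup>2" "\<kappa> \<le> 1"
proof -
  have dist_bound: "1 \<le> dist_bound\<^sup>2" using dist_bound_ge_1 by (simp add: one_le_power)
  then have "0 < dist_bound\<^sup>2" by linarith
  then show "0 < \<kappa>" "\<kappa> \<le> 1 / dist_bound\<^sup>2" using r1 by (auto simp: \<kappa>_def divide_right_mono)
  have "1 / dist_bound\<^sup>2 \<le> 1" using dist_bound \<open>0 < dist_bound\<^sup>2\<close> by (simp only: divide_le_eq_1_pos)
  then show "\<kappa> \<le> 1" using \<open>\<kappa> \<le> 1 / dist_bound\<^sup>2\<close> by linarith
qed

text \<open>
  This is needed for a decreasing right branch. There two cylinders on different sides of a common
  boundary point \<open>pull v 1\<close> may have their points \<open>pull w 0\<close> on the sides that face each other, so the gap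
  between the cylinders matters. The point \<open>pull (v @ u) 0\<close> coincides with the boundary point if \<open>u\<close> is
  the single letter \<open>R\<close>, since \<open>gR 0 = 1\<close>. Otherwise the gap is large: for empty \<open>u\<close> it is the whole
  cylinder; for \<open>u = R # u'\<close> the boundary point is \<open>pull (v @ [R]) 0\<close> and the nested case applies; for
  \<open>u = L # u'\<close> the gap contains the image under \<open>pull v\<close> of \<open>{r1..1}\<close>.
\<close>

lemma facing_separated:
  assumes "gR 0 = 1" and ret: "returning (v @ u)"
  shows "pull (v @ u) 0 = pull v 1 \<or> \<kappa> * width (v @ u) \<le> \<bar>pull v 1 - pull (v @ u) 0\<bar>"
proof (cases u)
  case Nil
  have "\<kappa> * width v \<le> width v" using \<kappa> width_pos[of v] by (intro mult_left_le_one_le) auto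
  then show ?thesis using Nil by (simp add: width_def)
next
  case (Cons b u')
  show ?thesis
  proof (cases b)
    case R
    have r: "returning (v @ [R])" by (simp add: returning_def)
    have 1: "pull (v @ [R]) 0 = pull v 1" using assms(1) by simp
    show ?thesis
    proof (cases "u' = []")
      case True
      then show ?thesis using 1 R Cons by simp
    next
      case False
      then have "R \<in> set u'" using ret last_in_set[of u'] Cons R by (auto simp: returning_def split: if_splits)
      from nested_separated[OF r this] show ?thesis
        using 1 R Cons by (simp add: \<kappa>_def)
    qed
  next
    case L
    then have u': "returning u'" "u' \<noteq> []" using ret Cons by (auto simp: returning_def split: if_splits)
    \<comment> \<open>The map pull v need not have bounded distortion, since v may end in a long run of L.
      That run is split off and treated by comparing lengths of level intervals.\<close>
    obtain v0 m where v: "v = v0 @ replicate m L" "returning v0" using returning_prefix by blast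
    define G where "G = gL ^^ m"
    have G01: "G t \<in> {0..1}" if "t \<in> {0..1}" for t unfolding G_def using that by (rule gL_funpow_in)
    define p p' where "p = pull u 0" and "p' = pull u 1"
    have p: "p \<in> {0..1}" "p' \<in> {0..1}" unfolding p_def p'_def by (rule pull_in; simp)+
    have "p \<le> r1" using gL(1)[OF pull_in, of 0 u'] by (simp add: p_def Cons L)
    have pv: "pull v t = pull v0 (G t)" for t by (simp add: v(1) pull_replicate G_def)
    have dist_bound: "0 < dist_bound" using dist_bound_ge_1 by linarith
    have "width (v @ u) = \<bar>pull v0 (G p') - pull v0 (G p)\<bar>"
      by (simp add: width_def pv p_def p'_def)
    also have "\<dots> \<le> dist_bound * width v0 * \<bar>G p' - G p\<bar>" using v(2) p G01 by (intro returning_similar) auto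
    also have "\<dots> \<le> dist_bound * width v0 * \<bar>G 1 - G r1\<bar>"
    proof -
      have "returning u" "u \<noteq> []" using u' Cons by (auto simp: returning_def)
      then have "\<bar>G p' - G p\<bar> \<le> \<bar>G 1 - G r1\<bar>"
        unfolding G_def p_def p'_def by (intro level_width_le) auto
      then show ?thesis using dist_bound width_pos[of v0] by (intro mult_left_mono) auto
    qed
    also have "\<dots> \<le> dist_bound * width v0 * \<bar>G 1 - G p\<bar>"
    proof -
      have "\<bar>G 1 - G r1\<bar> \<le> \<bar>G 1 - G p\<bar>"
        unfolding G_def pull_replicate[symmetric] using p \<open>p \<le> r1\<close> r1 by (intro pull_nest) auto
      then show ?thesis using dist_bound width_pos[of v0] by (intro mult_left_mono) auto
    qed
    also have "\<dots> \<le> dist_bound * (dist_bound * \<bar>pull v0 (G 1) - pull v0 (G p)\<bar>)"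
      using mult_left_mono[OF returning_similar(2)[OF v(2), of "G 1" "G p"], of dist_bound] G01 p dist_bound
      by (simp add: mult_ac)
    also have "\<dots> = dist_bound\<^sup>2 * \<bar>pull v 1 - pull (v @ u) 0\<bar>" by (simp add: pv p_def power2_eq_square)
    finally have "1 / dist_bound\<^sup>2 * width (v @ u) \<le> \<bar>pull v 1 - pull (v @ u) 0\<bar>"
      using dist_bound by (simp add: field_simps)
    moreover have "\<kappa> * width (v @ u) \<le> 1 / dist_bound\<^sup>2 * width (v @ u)"
      using \<kappa>(2) width_pos[of "v @ u"] by (intro mult_right_mono) auto
    ultimately show ?thesis by linarith
  qed
qed

lemma gR_orientation:
  obtains (inc) "gR 0 = r1" "gR 1 = 1" "strict_mono_on {0..1} gR"
  | (dec) "gR 0 = 1" "gR 1 = r1" "strict_antimono_on {0..1} gR"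
proof -
  have "gR 0 < gR 1" if "strict_mono_on {0..1} gR" using monotone_onD[OF that, of 0 1] by simp
  moreover have "gR 1 < gR 0" if "strict_antimono_on {0..1} gR" using monotone_onD[OF that, of 0 1] by simp
  ultimately show thesis using gR_monotone gR_ends r1 that by (auto simp: doubleton_eq_iff)
qed

text \<open>
  The point \<open>pull v r1\<close> lies between the two points, so it suffices that one of them is far from it. If
  \<open>gR\<close> increases, then so do all maps involved, and the cylinder of \<open>v @ L # u\<close> lies between its own left
  endpoint and \<open>pull v r1\<close>.
\<close>

lemma splitting_separated:
  assumes "returning (v @ L # u)" "returning (v @ R # u')"
  defines "w \<equiv> v @ L # u" and "w' \<equiv> v @ R # u'"
  assumes ne: "pull w 0 \<noteq> pull w' 0"
  shows "\<kappa> * min (width w) (width w') \<le> \<bar>pull w 0 - pull w' 0\<bar>"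
proof -
  define p p' where "p = gL (pull u 0)" and "p' = gR (pull u' 0)"
  have p: "p \<in> {0..r1}" "p' \<in> {r1..1}"
    unfolding p_def p'_def by (rule gL(1)[OF pull_in] gR(1)[OF pull_in]; simp)+
  have w: "pull w 0 = pull v p" "pull w' 0 = pull v p'" by (simp_all add: w_def w'_def p_def p'_def)
  have left: "\<bar>pull v r1 - pull w 0\<bar> \<le> \<bar>pull w 0 - pull w' 0\<bar>"
    and right: "\<bar>pull v r1 - pull w' 0\<bar> \<le> \<bar>pull w 0 - pull w' 0\<bar>"
    unfolding w using pull_nest[of p p' r1 p v] pull_nest[of p p' r1 p' v] p r1
    by (auto simp: abs_minus_commute)
  have "\<kappa> * width w \<le> \<bar>pull v r1 - pull w 0\<bar> \<or> \<kappa> * width w' \<le> \<bar>pull v r1 - pull w' 0\<bar>"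
  proof (cases rule: gR_orientation)
    case inc
    have "strict_mono_on {0..1} (pull u)"
    proof (induction u)
      case (Cons b u)
      have "strict_mono_on {0..1} (branch b)"
        using inc(3) gL_less by (cases b) (auto simp: monotone_on_def)
      then show ?case using Cons.IH pull_in[of _ u] by (auto simp: monotone_on_def)
    qed (simp add: monotone_on_def)
    from monotone_onD[OF this, of 0 1] have "gL (pull u 0) < gL (pull u 1)"
      using pull_in[of 0 u] pull_in[of 1 u] by (intro gL_less) auto
    moreover have "gL (pull u 1) \<le> r1" using gL(1)[OF pull_in, of 1 u] by simp
    ultimately have "width w \<le> \<bar>pull v r1 - pull v p\<bar>"
      unfolding width_def w_def using p r1 pull_nest[of p r1 "gL (pull u 1)" p v] by (simp add: p_def)
    moreover have "\<kappa> * width w \<le> width w" using \<kappa> width_pos[of w] by (intro mult_left_le_one_le) auto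
    ultimately show ?thesis using w by simp
  next
    case dec
    have "pull (v @ [L]) 1 = pull v r1" "pull (v @ [R]) 1 = pull v r1"
      using dec gL_ends by simp_all
    then show ?thesis
      using facing_separated[OF dec(1), of "v @ [L]" u] facing_separated[OF dec(1), of "v @ [R]" u'] assms ne
      unfolding w_def w'_def by auto
  qed
  moreover have "\<kappa> * min (width w) (width w') \<le> \<kappa> * width w" "\<kappa> * min (width w) (width w') \<le> \<kappa> * width w'"
    using \<kappa> by auto
  ultimately show ?thesis using left right by linarith
qed

lemma fork_cases:
  fixes w w' :: "side list"
  obtains (left) u where "w' = w @ u" | (right) u where "w = w' @ u"
  | (LR) v u u' where "w = v @ L # u" "w' = v @ R # u'"
  | (RL) v u u' where "w = v @ R # u" "w' = v @ L # u'"
proof (induction w arbitrary: w' thesis)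
  case Nil
  then show ?case by simp
next
  case (Cons b w)
  note prems = Cons.prems
  show ?case
  proof (cases w')
    case Nil
    then show ?thesis using prems(2) by simp
  next
    case w': (Cons b' w'')
    show ?thesis
    proof (cases "b = b'")
      case True
      show ?thesis
      proof (rule Cons.IH[of w''])
        show thesis if "w'' = w @ u" for u using prems(1) that True w' by simp
        show thesis if "w = w'' @ u" for u using prems(2) that True w' by simp
        show thesis if "w = v @ L # u" "w'' = v @ R # u'" for v u u'
          using prems(3)[of "b # v" u u'] that True w' by simp
        show thesis if "w = v @ R # u" "w'' = v @ L # u'" for v u u'
          using prems(4)[of "b # v" u u'] that True w' by simp
      qed
    next
      case False
      then show ?thesis using prems(3)[of "[]"] prems(4)[of "[]"] w' by (cases b; cases b') auto
    qed
  qed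
qed

text \<open>
  Different words can give the same point: if the right branch decreases, then \<open>pull v r1\<close> arises both from
  \<open>v @ [L, R]\<close> and from \<open>v @ [R, R]\<close>.
\<close>

lemma zeros_separated:
  assumes "returning w" "returning w'" "pull w 0 \<noteq> pull w' 0"
  shows "\<kappa> * min (width w) (width w') \<le> \<bar>pull w 0 - pull w' 0\<bar>"
proof -
  have nested: "\<kappa> * min (width w) (width (w @ u)) \<le> \<bar>pull w 0 - pull (w @ u) 0\<bar>"
    if "returning w" "returning (w @ u)" "u \<noteq> []" for w u
  proof -
    have "R \<in> set u" using that last_in_set[of u] by (auto simp: returning_def split: if_splits)
    then have "\<kappa> * width (w @ u) \<le> \<bar>pull w 0 - pull (w @ u) 0\<bar>"
      using nested_separated that unfolding \<kappa>_def by blast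
    moreover have "\<kappa> * min (width w) (width (w @ u)) \<le> \<kappa> * width (w @ u)" using \<kappa> by auto
    ultimately show ?thesis by linarith
  qed
  show ?thesis
  proof (cases rule: fork_cases[of w' w])
    case (left u)
    then show ?thesis using nested[of w u] assms by (cases "u = []") auto
  next
    case (right u)
    then show ?thesis using nested[of w' u] assms by (cases "u = []") (auto simp: abs_minus_commute min.commute)
  next
    case (LR v u u')
    then show ?thesis using splitting_separated[of v u u'] assms by auto
  next
    case (RL v u u')
    then show ?thesis using splitting_separated[of v u' u] assms by (auto simp: abs_minus_commute min.commute)
  qed
qed

section \<open>Orbits that avoid a neighbourhood of zero\<close>

text \<open>
  Suppose an orbit enters \<open>{0..<\<delta>}\<close> at some time, with \<open>\<delta> \<le> r1\<close>. The preceding step uses the right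
  branch, as the left branch does not decrease points. The itinerary \<open>w\<close> up to that time thus ends in \<open>R\<close>,
  and bounded distortion of \<open>pull w\<close> puts \<open>x\<close> within \<open>dist_bound * width w * \<delta>\<close> of \<open>pull w 0\<close>. The orbit
  cannot hit \<open>r1\<close> either, because \<open>r1\<close> is itself of the form \<open>pull w 0\<close>; so the value of \<open>f\<close> at \<open>r1\<close>
  does not interfere with the itinerary.
\<close>

lemma orbit_avoids_zero:
  assumes left: "\<And>x. x \<in> {0..<r1} \<Longrightarrow> f x = fl x" and right: "\<And>x. x \<in> {r1<..1} \<Longrightarrow> f x = fr x"
    and x: "x \<in> {r1..1}" and "0 < d"
    and avoid: "\<And>w. returning w \<Longrightarrow> w \<noteq> [] \<Longrightarrow> d * width w < \<bar>x - pull w 0\<bar>"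
  shows "(f ^^ m) x \<in> {min (d / dist_bound) r1..1} \<and> (f ^^ m) x \<noteq> r1"
proof -
  define \<delta> where "\<delta> = min (d / dist_bound) r1"
  have dist_bound: "0 < dist_bound" using dist_bound_ge_1 by linarith
  have \<delta>: "0 < \<delta>" "dist_bound * \<delta> \<le> d" "\<delta> \<le> r1"
    using \<open>0 < d\<close> dist_bound r1 by (auto simp: \<delta>_def min_def field_simps)
  obtain u0 where u0: "pull u0 0 = r1" "returning u0" "u0 \<noteq> []"
  proof (cases rule: gR_orientation)
    case inc
    then show ?thesis using that[of "[R]"] by (simp add: returning_def)
  next
    case dec
    then show ?thesis using that[of "[L, R]"] gL_ends by (simp add: returning_def)
  qed
  have not_r1: "y \<noteq> r1" if "pull w y = x" for w y
  proof
    assume "y = r1"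
    then have "x = pull (w @ u0) 0" using that u0 by simp
    moreover have "returning (w @ u0)" "w @ u0 \<noteq> []" using u0 by (auto simp: returning_def)
    ultimately have "d * width (w @ u0) < 0" using avoid[of "w @ u0"] by simp
    then show False using \<open>0 < d\<close> width_pos[of "w @ u0"] by (simp add: mult_less_0_iff)
  qed
  have "\<exists>w. length w = m \<and> pull w ((f ^^ m) x) = x \<and> (f ^^ m) x \<in> {\<delta>..1}"
  proof (induction m)
    case 0
    show ?case using x \<delta> by auto
  next
    case (Suc m)
    define y where "y = (f ^^ m) x"
    obtain w where w: "pull w y = x" "y \<in> {\<delta>..1}" "length w = m" using Suc y_def by blast
    have y: "y \<noteq> r1" using not_r1 w by blast
    have "\<exists>b. branch b (f y) = y \<and> f y \<in> {\<delta>..1}"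
    proof (cases "y < r1")
      case True
      then have y0: "y \<in> {0..<r1}" "y \<in> {0..r1}" using w \<delta> by auto
      have "y \<le> fl y" using fl_expand[of 0 y] fl_ends y0 by simp
      moreover have "fl y \<in> {0..1}" using fl_image y0(2) by blast
      ultimately have "branch L (f y) = y \<and> f y \<in> {\<delta>..1}"
        using left[OF y0(1)] gL_fl[OF y0(2)] w(2) by simp
      then show ?thesis by blast
    next
      case False
      then have y0: "y \<in> {r1<..1}" "y \<in> {r1..1}" using w y by auto
      have fy: "f y = fr y" "f y \<in> {0..1}" using right[OF y0(1)] fr_image y0(2) by auto
      then have b: "branch R (f y) = y" using gR_fr y0(2) by simp
      have ret: "returning (w @ [R])" "w @ [R] \<noteq> []" by (auto simp: returning_def)
      have "d * width (w @ [R]) < \<bar>pull (w @ [R]) (f y) - pull (w @ [R]) 0\<bar>"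
        using avoid[OF ret] w(1) b by simp
      also have "\<dots> \<le> dist_bound * width (w @ [R]) * \<bar>f y - 0\<bar>"
        using fy ret by (intro returning_similar) auto
      finally have "d < dist_bound * f y" using width_pos[of "w @ [R]"] fy(2) by (simp add: mult.commute)
      then have "dist_bound * \<delta> < dist_bound * f y" using \<delta>(2) by linarith
      then have "\<delta> < f y" using dist_bound by simp
      then show ?thesis using b fy(2) by (intro exI[of _ R]) auto
    qed
    then obtain b where "branch b (f y) = y" "f y \<in> {\<delta>..1}" by blast
    then have "pull (w @ [b]) (f y) = x" "length (w @ [b]) = Suc m" using w by auto
    then show ?case using \<open>f y \<in> {\<delta>..1}\<close> unfolding y_def by (intro exI[of _ "w @ [b]"]) (simp add: y_def)
  qed
  then show ?thesis using not_r1 unfolding \<delta>_def by blast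
qed

text \<open>
  On \<open>{\<delta>..<r1}\<close> the left branch moves points to the right by at least \<open>fl \<delta> - \<delta>\<close>, which is positive.
\<close>

lemma orbit_returns:
  assumes left: "\<And>x. x \<in> {0..<r1} \<Longrightarrow> f x = fl x" and "0 < \<delta>"
    and above: "\<And>m. (f ^^ m) y \<in> {\<delta>..1}"
  shows "\<exists>n\<ge>1. (f ^^ n) y \<in> {r1..1}"
proof (rule ccontr)
  assume no: "\<not> ?thesis"
  then have low: "(f ^^ n) y \<in> {\<delta>..<r1}" if "n \<ge> 1" for n
    using above[of n] that by (meson atLeastAtMost_iff atLeastLessThan_iff not_less)
  have "\<delta> < r1" using low[of 1] by auto
  define c where "c = fl \<delta> - \<delta>"
  obtain \<xi> where \<xi>: "0 < \<xi>" "\<xi> < \<delta>" "fl \<delta> - fl 0 = fl' \<xi> * (\<delta> - 0)"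
    using fl_mvt[of 0 \<delta>] \<open>0 < \<delta>\<close> \<open>\<delta> < r1\<close> by (metis less_imp_le order_refl)
  have "1 < fl' \<xi>" using \<xi> \<open>\<delta> < r1\<close> by (intro fl'_gt) auto
  then have "1 * \<delta> < fl' \<xi> * \<delta>" using \<open>0 < \<delta>\<close> by (intro mult_strict_right_mono) auto
  then have c: "0 < c" using \<xi> fl_ends by (simp add: c_def)
  have step: "z + c \<le> f z" if "z \<in> {\<delta>..<r1}" for z
  proof -
    have "z - \<delta> \<le> fl z - fl \<delta>" using that \<open>0 < \<delta>\<close> by (intro fl_expand) auto
    then show ?thesis using left[of z] that \<open>0 < \<delta>\<close> by (simp add: c_def)
  qed
  have grow: "real n * c \<le> (f ^^ Suc n) y" for n
  proof (induction n)
    case 0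
    show ?case using low[of 1] \<open>0 < \<delta>\<close> by simp
  next
    case (Suc n)
    have "(f ^^ Suc n) y + c \<le> f ((f ^^ Suc n) y)" by (intro step low) simp
    then show ?case using Suc by (simp add: algebra_simps)
  qed
  obtain n where "1 < real n * c" using reals_Archimedean3[OF c] by blast
  moreover have "(f ^^ Suc n) y \<le> 1" using above[of "Suc n"] by simp
  ultimately show False using grow[of n] by linarith
qed

text \<open>
  An orbit of the induced map is part of the \<open>f\<close>-orbit. Its members \<open>y\<close> lie in \<open>{r1..1}\<close> and satisfy
  \<open>fr y \<ge> \<delta>\<close>, a closed condition which fails at \<open>gR 0\<close>.
\<close>

lemma avoiding_subset_exceptional:
  assumes left: "\<And>x. x \<in> {0..<r1} \<Longrightarrow> f x = fl x" and right: "\<And>x. x \<in> {r1<..1} \<Longrightarrow> f x = fr x"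
    and F: "induced_map f r1 F"
  shows "{x \<in> {r1..1}. \<exists>d>0. \<forall>w\<in>{w. returning w \<and> w \<noteq> []}. d * width w < \<bar>x - pull w 0\<bar>}
    \<subseteq> exceptional_set F {r1..1} (gR 0)"
proof
  fix x assume "x \<in> {x \<in> {r1..1}. \<exists>d>0. \<forall>w\<in>{w. returning w \<and> w \<noteq> []}. d * width w < \<bar>x - pull w 0\<bar>}"
  then obtain d where x: "x \<in> {r1..1}" and d: "0 < d"
    and avoid: "\<And>w. returning w \<Longrightarrow> w \<noteq> [] \<Longrightarrow> d * width w < \<bar>x - pull w 0\<bar>" by blast
  define \<delta> where "\<delta> = min (d / dist_bound) r1"
  have orbit: "(f ^^ m) x \<in> {\<delta>..1}" "(f ^^ m) x \<noteq> r1" for m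
    using orbit_avoids_zero[OF left right x d avoid] unfolding \<delta>_def by blast+
  have \<delta>: "0 < \<delta>" using d dist_bound_ge_1 r1 by (simp add: \<delta>_def)
  have F_orbit: "\<exists>m. (F ^^ n) x = (f ^^ m) x \<and> (F ^^ n) x \<in> {r1..1}" for n
  proof (induction n)
    case 0
    show ?case using x by (intro exI[of _ 0]) simp
  next
    case (Suc n)
    define y where "y = (F ^^ n) x"
    obtain m where m: "y = (f ^^ m) x" "y \<in> {r1..1}" using Suc y_def by blast
    define N where "N = {k. k \<ge> 1 \<and> (f ^^ k) y \<in> {r1..1}}"
    have "(f ^^ k) y \<in> {\<delta>..1}" for k using orbit(1)[of "k + m"] by (simp add: m(1) funpow_add)
    then have "N \<noteq> {}" using orbit_returns[OF left \<delta>] unfolding N_def by blast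
    then have "Inf (enat ` N) \<in> enat ` N"
      unfolding Inf_enat_def by (auto intro: LeastI)
    then obtain k where k: "return_time f r1 y = enat k" "k \<in> N"
      unfolding return_time_def N_def by blast
    then have "F y = (f ^^ k) y" using F m(2) unfolding induced_map_def by (auto split: if_splits)
    moreover have "(f ^^ k) y = (f ^^ (k + m)) x" by (simp add: m(1) funpow_add)
    moreover have "(f ^^ k) y \<in> {r1..1}" using k(2) by (simp add: N_def)
    ultimately show ?case unfolding y_def by (metis comp_apply funpow.simps(2))
  qed
  let ?Z = "{y \<in> {r1..1}. \<delta> \<le> fr y}"
  have "closed ({r1..1} \<inter> fr -` {\<delta>..})" by (intro continuous_closed_preimage fr_cont) auto
  moreover have "{r1..1} \<inter> fr -` {\<delta>..} = ?Z" by auto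
  ultimately have "closed ?Z" by simp
  have "range (\<lambda>n. (F ^^ n) x) \<subseteq> ?Z"
  proof (rule image_subsetI)
    fix n
    obtain m where m: "(F ^^ n) x = (f ^^ m) x" "(F ^^ n) x \<in> {r1..1}" using F_orbit by blast
    then have "(f ^^ m) x \<in> {r1<..1}" using orbit(2)[of m] by auto
    then have "fr ((f ^^ m) x) = (f ^^ Suc m) x" using right by simp
    then show "(F ^^ n) x \<in> ?Z" using m orbit(1)[of "Suc m"] by auto
  qed
  then have "closure (range (\<lambda>n. (F ^^ n) x)) \<subseteq> ?Z" using \<open>closed ?Z\<close> by (rule closure_minimal)
  moreover have "gR 0 \<notin> ?Z" using gR(2)[of 0] \<delta> by simp
  ultimately show "x \<in> exceptional_set F {r1..1} (gR 0)" using x unfolding exceptional_set_def by blast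
qed

end

section \<open>Regularity of the branches of a Manneville--Pomeau map\<close>

text \<open>
  The image of \<open>{a..b}\<close> is closed, hence contains \<open>0\<close> and \<open>1\<close>; these values are left for the endpoints.
\<close>

lemma open_image_endpoints:
  fixes h :: "real \<Rightarrow> real"
  assumes "a < b" "continuous_on {a..b} h" "h ` {a<..<b} = {0<..<1}"
  shows "{0, 1} \<subseteq> {h a, h b}"
proof -
  have ab: "{a..b} = {a<..<b} \<union> {a, b}" using assms(1) by auto
  have "h ` {a..b} = {0<..<1} \<union> {h a, h b}"
    unfolding ab image_Un assms(3) by simp
  moreover have "closed (h ` {a..b})"
    using assms(2) by (intro compact_imp_closed compact_continuous_image) auto
  ultimately have "closure {0<..<1} \<subseteq> {0<..<1} \<union> {h a, h b}"
    by (metis Un_upper1 closure_minimal)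
  then have "{0..1} \<subseteq> {0<..<1} \<union> {h a, h b}" by simp
  moreover have "0 \<in> {0..1::real}" "1 \<in> {0..1::real}" by auto
  ultimately have "0 \<in> {0<..<1} \<union> {h a, h b}" "1 \<in> {0<..<1} \<union> {h a, h b}" by blast+
  then show ?thesis by auto
qed

text \<open>
  The derivative at an endpoint is a limit of difference quotients, which by the mean value theorem are
  values of the derivative at interior points. A Lipschitz bound therefore passes to the endpoint.
\<close>

lemma derivative_lipschitz_endpoint:
  fixes \<phi> \<phi>' :: "real \<Rightarrow> real"
  assumes "a < b" and deriv: "\<And>x. x \<in> {a..b} \<Longrightarrow> (\<phi> has_real_derivative \<phi>' x) (at x within {a..b})"
    and T: "{a<..<b} \<subseteq> T" and lip: "\<And>x y. x \<in> T \<Longrightarrow> y \<in> T \<Longrightarrow> \<bar>\<phi>' x - \<phi>' y\<bar> \<le> K * \<bar>x - y\<bar>"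
    and "0 \<le> K" "e \<in> {a, b}" "x \<in> T"
  shows "\<bar>\<phi>' x - \<phi>' e\<bar> \<le> K * \<bar>x - e\<bar>"
proof (rule field_le_epsilon)
  fix \<epsilon> :: real assume "0 < \<epsilon>"
  define \<eta> where "\<eta> = \<epsilon> / (K + 1)"
  have \<eta>: "0 < \<eta>" "K * \<eta> + \<eta> = \<epsilon>"
    using \<open>0 < \<epsilon>\<close> \<open>0 \<le> K\<close> by (auto simp: \<eta>_def field_simps add_nonneg_eq_0_iff) 
  have "((\<lambda>y. (\<phi> y - \<phi> e) / (y - e)) \<longlongrightarrow> \<phi>' e) (at e within {a..b})"
    using deriv[of e] assms(1,6) by (auto simp: has_field_derivative_iff)
  then have "eventually (\<lambda>y. dist ((\<phi> y - \<phi> e) / (y - e)) (\<phi>' e) < \<eta>) (at e within {a..b})"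
    using \<eta>(1) by (rule tendstoD)
  then obtain r where r: "0 < r"
    "\<And>y. y \<in> {a..b} \<Longrightarrow> y \<noteq> e \<Longrightarrow> dist y e < r \<Longrightarrow> dist ((\<phi> y - \<phi> e) / (y - e)) (\<phi>' e) < \<eta>"
    unfolding eventually_at by blast
  define s where "s = min (min r \<eta>) (b - a) / 2"
  have s: "0 < s" "s < r" "s < \<eta>" "s < b - a" using r(1) \<eta>(1) assms(1) by (auto simp: s_def)
  obtain \<xi> where \<xi>: "\<xi> \<in> {a<..<b}" "\<bar>\<xi> - e\<bar> < \<eta>" "\<bar>\<phi>' \<xi> - \<phi>' e\<bar> < \<eta>"
  proof (cases "e = a")
    case True
    obtain \<xi> where \<xi>: "a < \<xi>" "\<xi> < a + s" "\<phi> (a + s) - \<phi> a = \<phi>' \<xi> * (a + s - a)"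
    proof (rule mvt_within[of a "a + s" \<phi> \<phi>'])
      show "(\<phi> has_real_derivative \<phi>' x) (at x within {a..a + s})" if "x \<in> {a..a + s}" for x
        using deriv[of x] that s by (auto intro: DERIV_subset)
    qed (use s in auto)
    then have "(\<phi> (a + s) - \<phi> e) / (a + s - e) = \<phi>' \<xi>" using True s by simp
    then show ?thesis using that[of \<xi>] \<xi> r(2)[of "a + s"] True s by (auto simp: dist_real_def)
  next
    case False
    then have e: "e = b" using assms(6) by simp
    obtain \<xi> where \<xi>: "b - s < \<xi>" "\<xi> < b" "\<phi> b - \<phi> (b - s) = \<phi>' \<xi> * (b - (b - s))"
    proof (rule mvt_within[of "b - s" b \<phi> \<phi>'])
      show "(\<phi> has_real_derivative \<phi>' x) (at x within {b - s..b})" if "x \<in> {b - s..b}" for x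
        using deriv[of x] that s by (auto intro: DERIV_subset)
    qed (use s in auto)
    then have "(\<phi> (b - s) - \<phi> e) / (b - s - e) = \<phi>' \<xi>" using e s by (simp add: field_simps)
    then show ?thesis using that[of \<xi>] \<xi> r(2)[of "b - s"] e s by (auto simp: dist_real_def)
  qed
  have "\<bar>\<phi>' x - \<phi>' \<xi>\<bar> \<le> K * \<bar>x - \<xi>\<bar>" using lip[OF \<open>x \<in> T\<close>] \<xi>(1) T by blast
  also have "\<dots> \<le> K * (\<bar>x - e\<bar> + \<eta>)" using \<xi>(2) \<open>0 \<le> K\<close> by (intro mult_left_mono) auto
  finally show "\<bar>\<phi>' x - \<phi>' e\<bar> \<le> K * \<bar>x - e\<bar> + \<epsilon>"
    using \<xi>(3) \<eta>(2) by (simp add: distrib_left)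
qed

lemma powr_comparable:
  fixes x y c \<alpha> :: real
  assumes "0 < c" "c < 1" "0 < x" "0 < y" "x * c \<le> y" "y * c \<le> x"
  shows "x powr \<alpha> \<le> (1 / c) powr \<bar>\<alpha>\<bar> * y powr \<alpha>"
proof -
  have q: "x / y \<le> 1 / c" "y / x \<le> 1 / c" using assms by (auto simp: field_simps)
  have "(x / y) powr \<alpha> \<le> (1 / c) powr \<bar>\<alpha>\<bar>"
  proof (cases "0 \<le> \<alpha>")
    case True
    then show ?thesis using powr_mono2[of \<alpha> "x / y" "1 / c"] q assms by simp
  next
    case False
    have "(x / y) powr \<alpha> = (y / x) powr (- \<alpha>)" using assms by (simp add: powr_divide powr_minus_divide)
    also have "\<dots> \<le> (1 / c) powr (- \<alpha>)" using False q assms by (intro powr_mono2) auto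
    finally show ?thesis using False by simp
  qed
  then show ?thesis using assms by (simp add: powr_divide field_simps)
qed

text \<open>
  The bounds on \<open>f''\<close> concern the open branches only. Near \<open>r1\<close> they make the derivatives Lipschitz, so
  that these extend continuously to \<open>r1\<close>. This gives the mean value theorem for \<open>fl'\<close> up to \<open>r1\<close> and, by
  compactness of \<open>{r1..1}\<close>, a contraction factor \<open>\<theta> < 1\<close> for the right inverse branch. The oscillation
  bound \<open>fl'_osc\<close> holds because \<open>f''\<close> is comparable to \<open>x powr (\<gamma> - 1)\<close>, whose values at points with
  ratio between \<open>r1\<close> and \<open>1 / r1\<close> are comparable.
\<close>

lemma Manneville_Pomeau_branches:
  assumes "Manneville_Pomeau f r1"
  obtains fl fr fl' fr' \<theta> C K where "intermittent_branches fl fr fl' fr' r1 \<theta> C K"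
    "\<And>x. x \<in> {0..<r1} \<Longrightarrow> f x = fl x" "\<And>x. x \<in> {r1<..1} \<Longrightarrow> f x = fr x"
proof -
  have r1: "0 < r1" "r1 < 1" and im: "f ` {0<..<r1} = {0<..<1}" "f ` {r1<..<1} = {0<..<1}" and f0: "f 0 = 0"
    using assms unfolding Manneville_Pomeau_def by blast+
  obtain fl fr fl' fr' f'' :: "real \<Rightarrow> real" and C \<gamma> :: real where
    fl: "\<forall>x\<in>{0..<r1}. fl x = f x" and fr: "\<forall>x\<in>{r1<..1}. fr x = f x"
    and dl: "\<forall>x\<in>{0..r1}. (fl has_real_derivative fl' x) (at x within {0..r1})"
    and dr: "\<forall>x\<in>{r1..1}. (fr has_real_derivative fr' x) (at x within {r1..1})"
    and cl: "continuous_on {0..<r1} fl'"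
    and ddl: "\<forall>x\<in>{0<..<r1}. (fl' has_real_derivative f'' x) (at x within {0<..<r1})"
    and ddr: "\<forall>x\<in>{r1<..1}. (fr' has_real_derivative f'' x) (at x within {r1<..1})"
    and fl'0: "fl' 0 = 1" and gl: "\<forall>x\<in>{0<..r1}. \<bar>fl' x\<bar> > 1"
    and gr: "\<forall>x\<in>{r1..1}. \<bar>fr' x\<bar> > 1"
    and bd: "bdd_above ((\<lambda>x. \<bar>f'' x\<bar>) ` {r1<..1})"
    and C: "C \<ge> 1" and f'': "\<forall>x\<in>{0<..<r1}.
      inverse C \<le> f'' x / x powr (\<gamma> - 1) \<and> f'' x / x powr (\<gamma> - 1) \<le> C"
    using assms unfolding Manneville_Pomeau_def by (elim conjE exE) (rule that; assumption)
  note fl = fl[rule_format] and fr = fr[rule_format] and dl = dl[rule_format] and dr = dr[rule_format]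
    and ddl = ddl[rule_format] and ddr = ddr[rule_format] and gl = gl[rule_format] and gr = gr[rule_format]
    and f'' = f''[rule_format]

  have up: "f'' x \<le> C * x powr (\<gamma> - 1)" and low: "x powr (\<gamma> - 1) \<le> C * f'' x" if "x \<in> {0<..<r1}" for x
    using f''[OF that] that C by (auto simp: field_simps)
  have pos: "0 \<le> f'' x" if "x \<in> {0<..<r1}" for x
  proof -
    have "0 \<le> C * f'' x" using low[OF that] by (rule order_trans[rotated]) simp
    then show ?thesis using C by (simp add: zero_le_mult_iff)
  qed
  define \<Lambda> where "\<Lambda> = (1 / r1) powr \<bar>\<gamma> - 1\<bar>"
  have comp: "x powr (\<gamma> - 1) \<le> \<Lambda> * y powr (\<gamma> - 1)"
    if "0 < x" "0 < y" "x * r1 \<le> y" "y * r1 \<le> x" for x y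
    unfolding \<Lambda>_def using r1 that by (intro powr_comparable)
  have mvt_open: "\<exists>\<xi>. x < \<xi> \<and> \<xi> < y \<and> fl' y - fl' x = f'' \<xi> * (y - x)"
    if "0 < x" "x < y" "y < r1" for x y
  proof -
    obtain \<xi> where "x < \<xi>" "\<xi> < y" "fl' y - fl' x = f'' \<xi> * (y - x)"
    proof (rule mvt_within[OF \<open>x < y\<close>, of fl' f''])
      show "(fl' has_real_derivative f'' t) (at t within {x..y})" if "t \<in> {x..y}" for t
        using ddl[of t] that \<open>0 < x\<close> \<open>y < r1\<close> by (auto intro: DERIV_subset)
    qed
    then show ?thesis by blast
  qed
  \<comment> \<open>If \<gamma> < 1, then the second derivative is unbounded near 0, so the Lipschitz bound is taken
    on an interval away from 0; its left endpoint r1 * r1 is comparable to r1.\<close>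
  define B where "B = C * (\<Lambda> * r1 powr (\<gamma> - 1))"
  have B: "0 \<le> B" using C by (simp add: B_def \<Lambda>_def)
  have f''_B: "\<bar>f'' x\<bar> \<le> B" if "x \<in> {r1 * r1..<r1}" for x
  proof -
    have "0 < r1 * r1" using r1 by simp
    then have "0 < x" using that by (meson atLeastLessThan_iff less_le_trans)
    then have x: "x \<in> {0<..<r1}" "x * r1 \<le> r1" "r1 * r1 \<le> x"
      using that r1 mult_left_le[of r1 x] by auto
    have "f'' x \<le> C * x powr (\<gamma> - 1)" using up x by blast
    also have "\<dots> \<le> B" unfolding B_def using comp[of x r1] x C r1 by (intro mult_left_mono) auto
    finally show ?thesis using pos[OF x(1)] by simp
  qed
  have lip_l: "\<bar>fl' x - fl' y\<bar> \<le> B * \<bar>x - y\<bar>" if "x \<in> {r1 * r1<..<r1}" "y \<in> {r1 * r1<..<r1}" for x y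
  proof -
    have *: "\<bar>fl' y - fl' x\<bar> \<le> B * (y - x)" if xy: "r1 * r1 < x" "x < y" "y < r1" for x y
    proof -
      have "0 < x" using xy(1) r1 by (meson mult_pos_pos order_less_trans)
      then obtain \<xi> where \<xi>: "x < \<xi>" "\<xi> < y" "fl' y - fl' x = f'' \<xi> * (y - x)"
        using mvt_open xy by blast
      have "\<bar>f'' \<xi>\<bar> \<le> B" using \<xi> xy by (intro f''_B) auto
      then show ?thesis unfolding \<xi>(3) abs_mult using xy by (simp add: mult_right_mono)
    qed
    show ?thesis using *[of x y] *[of y x] that by (cases x y rule: linorder_cases) (auto simp: abs_minus_commute)
  qed
  have sq: "r1 * r1 < r1" using r1 by simp
  have end_l: "\<bar>fl' x - fl' r1\<bar> \<le> B * \<bar>x - r1\<bar>" if "x \<in> {r1 * r1<..<r1}" for x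
  proof (rule derivative_lipschitz_endpoint[OF sq, of fl fl'])
    show "(fl has_real_derivative fl' t) (at t within {r1 * r1..r1})" if "t \<in> {r1 * r1..r1}" for t
    proof -
      have "0 \<le> r1 * r1" by simp
      then have t: "t \<in> {0..r1}" using that by (meson atLeastAtMost_iff order_trans)
      have "{r1 * r1..r1} \<subseteq> {0..r1}" using \<open>0 \<le> r1 * r1\<close> by (simp only: atLeastatMost_subset_iff) simp
      then show ?thesis using dl[OF t] by (rule DERIV_subset[rotated])
    qed
  qed (use lip_l B that in auto)
  have cont_l: "continuous_on {0..r1} fl'"
    unfolding continuous_on_eq_continuous_within
  proof
    fix x assume x: "x \<in> {0..r1}"
    show "continuous (at x within {0..r1}) fl'"
    proof (cases "x = r1")
      case True
      have "(fl' \<longlongrightarrow> fl' r1) (at r1 within {0..r1})"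
        unfolding tendsto_iff eventually_at
      proof (intro allI impI)
        fix \<epsilon> :: real assume "0 < \<epsilon>"
        define r where "r = min (r1 - r1 * r1) (\<epsilon> / (B + 1))"
        have "0 < r" using sq \<open>0 < \<epsilon>\<close> B by (simp add: r_def)
        moreover have "dist (fl' y) (fl' r1) < \<epsilon>" if "y \<in> {0..r1}" "y \<noteq> r1" "dist y r1 < r" for y
        proof -
          have y: "y \<in> {r1 * r1<..<r1}" "\<bar>y - r1\<bar> < \<epsilon> / (B + 1)"
            using that by (auto simp: r_def dist_real_def)
          have "\<bar>fl' y - fl' r1\<bar> \<le> B * \<bar>y - r1\<bar>" using end_l y by blast
          also have "\<dots> \<le> (B + 1) * \<bar>y - r1\<bar>" by (simp add: mult_right_mono)
          also have "\<dots> < \<epsilon>" using y(2) B by (simp add: field_simps)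
          finally show ?thesis by (simp add: dist_real_def)
        qed
        ultimately show "\<exists>d>0. \<forall>y\<in>{0..r1}. y \<noteq> r1 \<and> dist y r1 < d \<longrightarrow> dist (fl' y) (fl' r1) < \<epsilon>" by blast
      qed
      then show ?thesis using True by (simp add: continuous_within)
    next
      case False
      then have "continuous (at x within {0..<r1}) fl'" using cl x by (simp add: continuous_on_eq_continuous_within)
      moreover have "at x within {0..r1} = at x within {0..<r1}"
        by (rule at_within_nhd[of x "{..<r1}"]) (use x False in auto)
      ultimately show ?thesis by (simp add: continuous_within)
    qed
  qed
  have mvt_l: "\<exists>\<xi>. x < \<xi> \<and> \<xi> < y \<and> fl' y - fl' x = f'' \<xi> * (y - x)" if xy: "0 \<le> x" "x < y" "y \<le> r1" for x y
  proof -
    have d: "(fl' has_real_derivative f'' t) (at t)" if "x < t" "t < y" for t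
      using ddl[of t] that xy at_within_open[of t "{0<..<r1}"] by auto
    have "\<exists>l z. x < z \<and> z < y \<and> DERIV fl' z :> l \<and> fl' y - fl' x = (y - x) * l"
      using xy d by (intro MVT continuous_on_subset[OF cont_l]) (auto simp: real_differentiable_def)
    then show ?thesis using d DERIV_unique by (metis mult.commute)
  qed
  have mono_l: "fl' x \<le> fl' y" if xy: "0 \<le> x" "x \<le> y" "y \<le> r1" for x y
  proof (cases "x = y")
    case False
    then obtain \<xi> where \<xi>: "x < \<xi>" "\<xi> < y" "fl' y - fl' x = f'' \<xi> * (y - x)" using mvt_l[of x y] xy by auto
    then have "0 \<le> f'' \<xi>" using xy by (intro pos) auto
    then have "0 \<le> f'' \<xi> * (y - x)" using xy by simp
    then show ?thesis using \<xi>(3) by linarith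
  qed simp
  have osc_l: "(fl' y - fl' x) * (b - a) \<le> (C * C * \<Lambda>) * (fl' b - fl' a) * (y - x)"
    if h: "0 < a" "b * r1 \<le> a" "b \<le> r1" "a \<le> x" "x \<le> y" "y \<le> b" for a b x y
  proof (cases "x = y")
    case False
    then have lt: "x < y" "a < b" using h by auto
    obtain \<eta> where \<eta>: "x < \<eta>" "\<eta> < y" "fl' y - fl' x = f'' \<eta> * (y - x)" using mvt_l[of x y] lt h by auto
    obtain \<xi> where \<xi>: "a < \<xi>" "\<xi> < b" "fl' b - fl' a = f'' \<xi> * (b - a)" using mvt_l[of a b] lt h by auto
    have in_l: "\<eta> \<in> {0<..<r1}" "\<xi> \<in> {0<..<r1}" using \<eta> \<xi> h by auto
    have "\<eta> * r1 \<le> b * r1" "\<xi> * r1 \<le> b * r1" using \<eta> \<xi> h r1 by (auto intro!: mult_right_mono)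
    then have "\<eta> * r1 \<le> \<xi>" "\<xi> * r1 \<le> \<eta>" using \<eta>(1) \<xi>(1) h(2,4) by linarith+
    then have cmp: "\<eta> powr (\<gamma> - 1) \<le> \<Lambda> * \<xi> powr (\<gamma> - 1)" using in_l by (intro comp) auto
    have "f'' \<eta> \<le> C * \<eta> powr (\<gamma> - 1)" using up in_l by blast
    also have "\<dots> \<le> C * (\<Lambda> * \<xi> powr (\<gamma> - 1))" using cmp C by (intro mult_left_mono) auto
    also have "\<dots> \<le> C * (\<Lambda> * (C * f'' \<xi>))" using low[OF in_l(2)] C by (intro mult_left_mono) (auto simp: \<Lambda>_def)
    finally have "f'' \<eta> * ((y - x) * (b - a)) \<le> C * (\<Lambda> * (C * f'' \<xi>)) * ((y - x) * (b - a))"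
      using lt by (intro mult_right_mono) auto
    then show ?thesis unfolding \<eta>(3) \<xi>(3) by (simp add: mult_ac)
  qed simp
  have gt_l: "1 < fl' x" if "0 < x" "x \<le> r1" for x
    using gl[of x] mono_l[of 0 x] fl'0 that by auto
  have fl0: "fl 0 = 0" using fl[of 0] f0 r1 by simp
  have "fl ` {0<..<r1} = {0<..<1}" using im(1) fl by (metis (no_types, lifting) atLeastLessThan_iff greaterThanLessThan_iff image_cong less_imp_le)
  then have fl1: "fl r1 = 1"
    using open_image_endpoints[OF r1(1) DERIV_continuous_on[OF dl]] fl0 by auto

  obtain K where K: "\<And>x. x \<in> {r1<..1} \<Longrightarrow> \<bar>f'' x\<bar> \<le> K" using bd unfolding bdd_above_def by blast
  have "0 \<le> K" using K[of 1] r1 by auto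
  have lip_r0: "\<bar>fr' x - fr' y\<bar> \<le> K * \<bar>x - y\<bar>" if "x \<in> {r1<..1}" "y \<in> {r1<..1}" for x y
  proof -
    have *: "\<bar>fr' y - fr' x\<bar> \<le> K * (y - x)" if xy: "r1 < x" "x < y" "y \<le> 1" for x y
    proof -
      obtain \<xi> where \<xi>: "x < \<xi>" "\<xi> < y" "fr' y - fr' x = f'' \<xi> * (y - x)"
      proof (rule mvt_within[OF xy(2), of fr' f''])
        show "(fr' has_real_derivative f'' t) (at t within {x..y})" if "t \<in> {x..y}" for t
          using ddr[of t] that xy by (auto intro: DERIV_subset)
      qed
      have "\<bar>f'' \<xi>\<bar> \<le> K" using \<xi> xy by (intro K) auto
      then show ?thesis unfolding \<xi>(3) abs_mult using xy by (simp add: mult_right_mono)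
    qed
    show ?thesis using *[of x y] *[of y x] that by (cases x y rule: linorder_cases) (auto simp: abs_minus_commute)
  qed
  have end_r: "\<bar>fr' x - fr' r1\<bar> \<le> K * \<bar>x - r1\<bar>" if "x \<in> {r1<..1}" for x
    by (rule derivative_lipschitz_endpoint[OF r1(2) dr, where T = "{r1<..1}"]) (use lip_r0 \<open>0 \<le> K\<close> that in auto)
  have lip_r: "\<bar>fr' x - fr' y\<bar> \<le> K * \<bar>x - y\<bar>" if "x \<in> {r1..1}" "y \<in> {r1..1}" for x y
    using lip_r0[of x y] end_r[of x] end_r[of y] that
    by (cases "x = r1"; cases "y = r1") (auto simp: abs_minus_commute)
  have "K-lipschitz_on {r1..1} fr'"
    using lip_r \<open>0 \<le> K\<close> by (intro lipschitz_onI) (auto simp: dist_real_def)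
  then have "continuous_on {r1..1} (\<lambda>x. \<bar>fr' x\<bar>)"
    by (intro continuous_intros lipschitz_on_continuous_on)
  then obtain c where c: "c \<in> {r1..1}" "\<And>x. x \<in> {r1..1} \<Longrightarrow> \<bar>fr' c\<bar> \<le> \<bar>fr' x\<bar>"
    using continuous_attains_inf[of "{r1..1}" "\<lambda>x. \<bar>fr' x\<bar>"] r1 by auto
  have c1: "1 < \<bar>fr' c\<bar>" using gr c(1) by blast
  have ge_r: "1 \<le> 1 / \<bar>fr' c\<bar> * \<bar>fr' x\<bar>" if "x \<in> {r1..1}" for x
    using c(2)[OF that] c1 by (simp add: field_simps)
  have "fr ` {r1<..<1} = {0<..<1}" using im(2) fr by (metis (no_types, lifting) greaterThanAtMost_iff greaterThanLessThan_iff image_cong less_imp_le)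
  then have ends_r: "{fr r1, fr 1} = {0, 1}"
    using open_image_endpoints[OF r1(2) DERIV_continuous_on[OF dr]] by auto

  have "intermittent_branches fl fr fl' fr' r1 (1 / \<bar>fr' c\<bar>) (C * C * \<Lambda>) K"
  proof
    show "0 \<le> C * C * \<Lambda>" using C by (simp add: \<Lambda>_def)
    show "0 < 1 / \<bar>fr' c\<bar>" "1 / \<bar>fr' c\<bar> < 1" using c1 by auto
  qed (fact r1 dl fl0 fl1 mono_l gt_l osc_l dr ends_r lip_r ge_r \<open>0 \<le> K\<close> | simp add: fl'0)+
  then show thesis using that fl fr by metis
qed

section \<open>The exceptional set\<close>

theorem theorem4p1:
  fixes f F :: "real \<Rightarrow> real" and r1 q :: real
  assumes "Manneville_Pomeau f r1"
    and "induced_map f r1 F"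
    and "strict_mono_on {r1<..1} f \<Longrightarrow> q = r1"
    and "strict_antimono_on {r1<..1} f \<Longrightarrow> q = 1"
  shows "absolute_winning {r1..1} (exceptional_set F {r1..1} q)"
proof -
  obtain fl fr fl' fr' \<theta> C K where loc: "intermittent_branches fl fr fl' fr' r1 \<theta> C K"
    and left: "\<And>x. x \<in> {0..<r1} \<Longrightarrow> f x = fl x" and right: "\<And>x. x \<in> {r1<..1} \<Longrightarrow> f x = fr x"
    using Manneville_Pomeau_branches[OF assms(1)] by blast
  interpret intermittent_branches fl fr fl' fr' r1 \<theta> C K by (rule loc)
  have q: "q = gR 0"
  proof (cases rule: fr_cases)
    case inc
    have "strict_mono_on {r1<..1} f" using inc(1) right by (auto simp: monotone_on_def)
    then have "q = r1" by (rule assms(3))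
    also have "r1 = gR (fr r1)" using gR_fr[of r1] r1 by simp
    finally show ?thesis by (simp add: inc(2))
  next
    case dec
    have "strict_antimono_on {r1<..1} f" using dec(1) right by (auto simp: monotone_on_def)
    then have "q = 1" by (rule assms(4))
    also have "1 = gR (fr 1)" using gR_fr[of 1] r1 by simp
    finally show ?thesis by (simp add: dec(3))
  qed
  have "absolute_winning {r1..1}
    {x \<in> {r1..1}. \<exists>d>0. \<forall>w\<in>{w. returning w \<and> w \<noteq> []}. d * width w < \<bar>x - pull w 0\<bar>}"
    by (rule absolute_winning_avoid_separated[where \<kappa> = \<kappa>])
      (use \<kappa>(1) zeros_separated width_pos width_le_1 in auto)
  then show ?thesis
    using avoiding_subset_exceptional[OF left right assms(2)] unfolding q by (rule absolute_winning_mono)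
qed

end
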